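(* Let $X$ be a Hausdorff locally convex space with topological dual $X^*$, let $T$ be a finite set, let $\{f_t\}_{t\in T}\subseteq\Gamma_0(X)$, and let $T_0\subset T$, with $T_0^c=T\setminus T_0$. Then the following hold. (i) If $\bigcap_{t\in T_0}\operatorname{ri}_{\operatorname{aff}(\operatorname{dom}f_t)}(\operatorname{dom}f_t)\cap\bigcap_{t\in T_0^c}\operatorname{dom}f_t\neq\emptyset$ and each $f_t$ with $t\in T_0$ is continuous on $\operatorname{ri}_{\operatorname{aff}(\operatorname{dom}f_t)}(\operatorname{dom}f_t)$, then for every $x\in X$ $$ \partial\Big(\sum_{t\in T}f_t\Big)(x)=\bigcap_{\varepsilon>0}\operatorname{cl}^{w^*}\Big\{\sum_{t\in T_0}\partial f_t(x)+\sum_{t\in T_0^c}\partial_\varepsilon f_t(x)\Big\}. $$ (ii) If $\bigcap_{t\in T_0}\operatorname{int}(\operatorname{dom}f_t)\cap\bigcap_{t\in T_0^c}\operatorname{dom}f_t\neq\emptyset$ and each $f_t$ with $t\in T_0$ is continuous on $\operatorname{int}(\operatorname{dom}f_t)$, then for every $x\in X$ $$ \partial\Big(\sum_{t\in T}f_t\Big)(x)=\sum_{t\in T_0}\partial f_t(x)+\bigcap_{\varepsilon>0}\operatorname{cl}^{w^*}\Big\{\sum_{t\in T_0^c}\partial_\varepsilon f_t(x)\Big\}. $$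
   Context: $\Gamma_0(X)$ is the class of proper lower semicontinuous convex functions on $X$. $\operatorname{dom}g=\{g<+\infty\}$. $\operatorname{aff}$ is the affine hull, and $\operatorname{ri}_{\operatorname{aff}(A)}(A)$ is the interior of $A$ with respect to the topology induced on $\operatorname{aff}(A)$; continuity of $f_t$ on $\operatorname{ri}_{\operatorname{aff}(\operatorname{dom}f_t)}(\operatorname{dom}f_t)$ is meant relative to $\operatorname{aff}(\operatorname{dom}f_t)$. For $\varepsilon\ge0$, $\partial_\varepsilon g(x)=\{x^*\in X^*:\langle x^*,y-x\rangle\le g(y)-g(x)+\varepsilon\ \forall y\in X\}$ if $g(x)\in\mathbb R$, and $\emptyset$ otherwise; $\partial=\partial_0$. $\operatorname{cl}^{w^*}$ is weak$^*$ closure in $X^*$. *)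

theory Defs
  imports "HOL-Analysis.Analysis" "HOL-Library.Function_Algebras"
begin

text \<open>
  Real locally convex spaces; the Hausdorff property is expressed separately by the
  class \<^class>\<open>t2_space\<close>. Convexity of \<open>V\<close> is written out because \<^const>\<open>convex\<close> is not
  available inside the class specification.
\<close>

class locally_convex_space = real_vector + topological_ab_group_add +
  assumes tendsto_scaleR_Pair: "LIM p (nhds c \<times>\<^sub>F nhds a). fst p *\<^sub>R snd p :> nhds (c *\<^sub>R a)"
    and convex_nhds_base_0:
      "open U \<Longrightarrow> 0 \<in> U \<Longrightarrow>
        \<exists>V. open V \<and> 0 \<in> V \<and> V \<subseteq> U \<and>
          (\<forall>x\<in>V. \<forall>y\<in>V. \<forall>u\<ge>0. \<forall>v\<ge>0. u + v = 1 \<longrightarrow> u *\<^sub>R x + v *\<^sub>R y \<in> V)"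

instance real_normed_vector \<subseteq> locally_convex_space
proof
  fix c :: real and a :: 'a
  show "LIM p (nhds c \<times>\<^sub>F nhds a). fst p *\<^sub>R snd p :> nhds (c *\<^sub>R a)"
    unfolding nhds_prod[symmetric]
    using tendsto_fst[OF filterlim_ident, of "(c,a)"] tendsto_snd[OF filterlim_ident, of "(c,a)"]
    by (auto intro!: tendsto_scaleR)
next
  fix U :: "'a set"
  assume "open U" "0 \<in> U"
  then obtain e where "e > 0" "ball 0 e \<subseteq> U"
    using open_contains_ball by blast
  then have "open (ball 0 e) \<and> 0 \<in> ball 0 e \<and> ball 0 e \<subseteq> U \<and> convex (ball (0::'a) e)"
    by auto
  then show "\<exists>V. open V \<and> 0 \<in> V \<and> V \<subseteq> U \<and>
      (\<forall>x\<in>V. \<forall>y\<in>V. \<forall>u\<ge>0. \<forall>v\<ge>0. u + v = 1 \<longrightarrow> u *\<^sub>R x + v *\<^sub>R y \<in> V)"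
    unfolding convex_def by blast
qed

definition topological_dual :: "('a::{real_vector,topological_space} \<Rightarrow> real) set" where
  "topological_dual = {\<phi>. linear \<phi> \<and> continuous_on UNIV \<phi>}"

text \<open>The weak* topology is the topology of pointwise convergence on the dual.\<close>

definition weak_star_topology :: "('a::{real_vector,topological_space} \<Rightarrow> real) topology" where
  "weak_star_topology = subtopology (powertop_real UNIV) topological_dual"

definition eff_dom :: "('a \<Rightarrow> ereal) \<Rightarrow> 'a set" where
  "eff_dom g = {x. g x < \<infinity>}"

definition proper_fun :: "('a \<Rightarrow> ereal) \<Rightarrow> bool" where
  "proper_fun g \<longleftrightarrow> eff_dom g \<noteq> {} \<and> (\<forall>x. g x > -\<infinity>)"

definition lower_semicont :: "('a::topological_space \<Rightarrow> ereal) \<Rightarrow> bool" where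
  "lower_semicont g \<longleftrightarrow> (\<forall>x. \<forall>c<g x. \<forall>\<^sub>F y in nhds x. c < g y)"

text \<open>
  Only used for functions that never take the value \<open>-\<infinity>\<close>, so that no sum \<open>\<infinity> + -\<infinity>\<close> occurs.
\<close>

definition convex_fun :: "('a::real_vector \<Rightarrow> ereal) \<Rightarrow> bool" where
  "convex_fun g \<longleftrightarrow>
    (\<forall>x y. \<forall>u>0. \<forall>v>0. u + v = 1 \<longrightarrow> g (u *\<^sub>R x + v *\<^sub>R y) \<le> ereal u * g x + ereal v * g y)"

definition Gamma0 :: "('a::{real_vector,topological_space} \<Rightarrow> ereal) set" where
  "Gamma0 = {g. proper_fun g \<and> lower_semicont g \<and> convex_fun g}"

definition eps_subdiff ::
    "real \<Rightarrow> ('a::{real_vector,topological_space} \<Rightarrow> ereal) \<Rightarrow> 'a \<Rightarrow> ('a \<Rightarrow> real) set" where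
  "eps_subdiff \<epsilon> g x =
    (if \<bar>g x\<bar> \<noteq> \<infinity>
     then {\<phi> \<in> topological_dual. \<forall>y. ereal (\<phi> (y - x)) \<le> g y - g x + ereal \<epsilon>}
     else {})"

abbreviation subdiff ::
    "('a::{real_vector,topological_space} \<Rightarrow> ereal) \<Rightarrow> 'a \<Rightarrow> ('a \<Rightarrow> real) set" where
  "subdiff \<equiv> eps_subdiff 0"

end

theory Submission
  imports Defs
begin

text \<open>
  Write \<open>F\<close> for the sum of the \<open>f t\<close>. Subgradients add up, \<open>\<epsilon>\<close>-subgradients add up with their
  errors, and the set of \<open>\<epsilon>\<close>-subgradients is described by weak* closed inequalities; so both right-hand
  sides lie in the subdifferential of \<open>F\<close> as soon as \<open>\<epsilon>\<close> tends to \<open>0\<close>.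

  For the converse in (i), put \<open>A t\<close> for the set \<open>\<partial>f\<^sub>t(x)\<close> if \<open>t \<in> T\<^sub>0\<close> and for \<open>\<partial>\<^sub>\<epsilon>f\<^sub>t(x)\<close> otherwise, and
  suppose that \<open>\<phi> \<in> \<partial>F(x)\<close> is not in the weak* closure of the convex set \<open>\<Sum>A t\<close>. A weak* continuous
  linear functional is an evaluation, so some \<open>h\<close> satisfies \<open>\<Sum>\<sigma>\<^sub>t(h) < \<phi>(h)\<close>, where \<open>\<sigma>\<^sub>t\<close> is the support
  function of \<open>A t\<close>. On the other hand \<open>\<phi>\<close> is dominated by the sum of the directional derivatives
  \<open>f\<^sub>t'(x;\<cdot>)\<close>. These are compared with the \<open>\<sigma>\<^sub>t\<close> not in the direction \<open>h\<close>, where the comparison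
  may fail, but in \<open>h + \<delta>u\<close>, where \<open>u = x\<^sub>0 - x\<close> points to the given common point \<open>x\<^sub>0\<close> of the domains. It will be shown
  that \<open>f\<^sub>t'(x;h + \<delta>u) \<le> \<sigma>\<^sub>t(h) + \<delta>(B\<^sub>t + 2)\<close> with \<open>B\<^sub>t\<close> independent of \<open>\<delta>\<close>; summing over \<open>t\<close> and letting
  \<open>\<delta>\<close> tend to \<open>0\<close> contradicts the choice of \<open>h\<close> (\<open>subdiff_sum_subset_closure\<close>).

  For \<open>t \<notin> T\<^sub>0\<close> the comparison follows from \<open>f\<^sub>t'(x;k) \<le> \<sigma>\<^sub>t(k)\<close>, valid in every direction \<open>k\<close> because \<open>f\<^sub>t\<close> is
  lower semicontinuous and \<open>\<epsilon> > 0\<close> (\<open>eps_subdiff_support\<close>). For \<open>t \<in> T\<^sub>0\<close> it is a lower semicontinuity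
  property of the directional derivative: since \<open>f\<^sub>t\<close> is bounded above near \<open>x\<^sub>0\<close> relative to the affine hull
  of its domain, \<open>f\<^sub>t'(x;\<cdot>)\<close> is bounded above near \<open>u\<close> relative to the parallel subspace, so its values near
  \<open>h\<close> cannot be much smaller than its value at \<open>h + \<delta>u\<close>; and the parallel subspace is closed because \<open>f\<^sub>t\<close>
  is lower semicontinuous (\<open>subdiff_support\<close>). That the derivatives are finite at \<open>u\<close> comes from \<open>\<phi>\<close>:
  each of them is bounded above at \<open>u\<close> and their sum is at least \<open>\<phi>(u)\<close>.

  Part (ii) is the exact sum rule of Moreau and Rockafellar, which splits off the functions that are
  continuous at an interior point (\<open>subdiff_sum_split\<close>), combined with (i) for the remaining sum and an
  empty \<open>T\<^sub>0\<close>.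

  All functionals come from one form of the Hahn-Banach theorem, \<open>convex_linear_minorant\<close>: a convex
  subset of \<open>V \<times> \<real>\<close>, read as a set of upper bounds \<open>\<psi> w \<le> r\<close> for an unknown linear \<open>\<psi>\<close>, can be satisfied
  if it does not contain a negative bound at the origin and bounds \<open>\<psi>\<close> in every direction.
\<close>

section \<open>Linear minorants of sublinear functionals\<close>

definition sublinear_functional :: "('a::real_vector \<Rightarrow> real) \<Rightarrow> bool" where
  "sublinear_functional q \<longleftrightarrow>
    (\<forall>x y. q (x + y) \<le> q x + q y) \<and> (\<forall>t>0. \<forall>x. q (t *\<^sub>R x) = t * q x)"

lemma sublinear_functional_add: "sublinear_functional q \<Longrightarrow> q (x + y) \<le> q x + q y"
  by (simp add: sublinear_functional_def)

lemma sublinear_functional_scale: "sublinear_functional q \<Longrightarrow> t > 0 \<Longrightarrow> q (t *\<^sub>R x) = t * q x"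
  by (simp add: sublinear_functional_def)

lemma sublinear_functional_zero:
  assumes "sublinear_functional q" shows "q 0 = 0"
  using sublinear_functional_scale[OF assms, of 2 0] by simp

lemma sublinear_functional_lower:
  assumes "sublinear_functional q" shows "- q (- x) \<le> q x"
  using sublinear_functional_add[OF assms, of x "- x"] sublinear_functional_zero[OF assms] by simp

text \<open>
  The lower bounds needed for Zorn's lemma. The infimum is finite because \<open>- q (- x) \<le> m x\<close> for every
  sublinear \<open>m \<le> q\<close>; it is subadditive because the smaller of two members of a chain serves both summands.
\<close>

lemma sublinear_functional_INF_chain:
  assumes ne: "C \<noteq> {}" and sub: "\<And>m. m \<in> C \<Longrightarrow> sublinear_functional m"
    and le: "\<And>m. m \<in> C \<Longrightarrow> m \<le> q"
    and chain: "\<And>m m'. m \<in> C \<Longrightarrow> m' \<in> C \<Longrightarrow> m \<le> m' \<or> m' \<le> m"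
  shows "sublinear_functional (\<lambda>x. INF m\<in>C. m x)"
    and "\<And>m x. m \<in> C \<Longrightarrow> (INF m\<in>C. m x) \<le> m x"
proof -
  have bdd: "bdd_below ((\<lambda>m. m x) ` C)" for x
  proof (rule bdd_belowI2)
    fix m assume m: "m \<in> C"
    show "- q (- x) \<le> m x"
      using sublinear_functional_lower[OF sub[OF m], of x] le[OF m, THEN le_funD, of "- x"] by linarith
  qed
  show lower: "(INF m\<in>C. m x) \<le> m x" if "m \<in> C" for m x
    by (rule cINF_lower[OF bdd that])
  show "sublinear_functional (\<lambda>x. INF m\<in>C. m x)"
    unfolding sublinear_functional_def
  proof (intro conjI allI impI)
    fix x y
    have *: "(INF m\<in>C. m (x + y)) \<le> m1 x + m2 y" if mm: "m1 \<in> C" "m2 \<in> C" for m1 m2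
    proof -
      obtain m where m: "m \<in> C" "m \<le> m1" "m \<le> m2" using chain[OF mm] mm by blast
      have "(INF m\<in>C. m (x + y)) \<le> m (x + y)" by (rule lower[OF m(1)])
      also have "\<dots> \<le> m x + m y" by (rule sublinear_functional_add[OF sub[OF m(1)]])
      also have "\<dots> \<le> m1 x + m2 y" using m(2,3)[THEN le_funD] by (rule add_mono)
      finally show ?thesis .
    qed
    have "(INF m\<in>C. m (x + y)) - m1 x \<le> (INF m\<in>C. m y)" if "m1 \<in> C" for m1
      by (rule cINF_greatest[OF ne]) (use *[OF that] in \<open>simp add: algebra_simps\<close>)
    then have "(INF m\<in>C. m (x + y)) - (INF m\<in>C. m y) \<le> (INF m\<in>C. m x)"
      by (intro cINF_greatest[OF ne]) (simp add: algebra_simps)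
    then show "(INF m\<in>C. m (x + y)) \<le> (INF m\<in>C. m x) + (INF m\<in>C. m y)" by simp
  next
    fix t :: real and x assume t: "t > 0"
    show "(INF m\<in>C. m (t *\<^sub>R x)) = t * (INF m\<in>C. m x)"
    proof (rule antisym)
      have "(INF m\<in>C. m (t *\<^sub>R x)) / t \<le> (INF m\<in>C. m x)"
      proof (rule cINF_greatest[OF ne])
        fix m assume m: "m \<in> C"
        show "(INF m\<in>C. m (t *\<^sub>R x)) / t \<le> m x"
          using lower[OF m, of "t *\<^sub>R x"] sublinear_functional_scale[OF sub[OF m] t, of x] t
          by (simp add: field_simps)
      qed
      then show "(INF m\<in>C. m (t *\<^sub>R x)) \<le> t * (INF m\<in>C. m x)" using t by (simp add: field_simps)
    next
      show "t * (INF m\<in>C. m x) \<le> (INF m\<in>C. m (t *\<^sub>R x))"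
      proof (rule cINF_greatest[OF ne])
        fix m assume m: "m \<in> C"
        show "t * (INF m\<in>C. m x) \<le> m (t *\<^sub>R x)"
          using lower[OF m, of x] sublinear_functional_scale[OF sub[OF m] t, of x] t by simp
      qed
    qed
  qed
qed

text \<open>
  Lowering \<open>m\<close> along the ray through \<open>y\<close> keeps it sublinear. A minimal sublinear functional is therefore
  unchanged by this operation, and the bound at \<open>t = 1\<close> then says that it is superadditive.
\<close>

lemma sublinear_functional_INF_ray:
  fixes m :: "'a::real_vector \<Rightarrow> real" and y :: 'a
  assumes m: "sublinear_functional m"
  defines "n \<equiv> \<lambda>x. INF t\<in>{0..}. m (x + t *\<^sub>R y) - t * m y"
  shows "sublinear_functional n" and "\<And>t x. t \<ge> 0 \<Longrightarrow> n x \<le> m (x + t *\<^sub>R y) - t * m y"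
proof -
  have scale: "m (t *\<^sub>R x) = t * m x" if "t \<ge> 0" for t x
    using that sublinear_functional_scale[OF m, of t x] sublinear_functional_zero[OF m]
    by (cases "t = 0") auto
  have bdd: "bdd_below ((\<lambda>t. m (x + t *\<^sub>R y) - t * m y) ` {0..})" for x
  proof (rule bdd_belowI2)
    fix t :: real assume t: "t \<in> {0..}"
    have "m (t *\<^sub>R y) \<le> m (x + t *\<^sub>R y) + m (- x)"
      using sublinear_functional_add[OF m, of "x + t *\<^sub>R y" "- x"] by simp
    then show "- m (- x) \<le> m (x + t *\<^sub>R y) - t * m y" using scale t by simp
  qed
  have ne: "{0::real..} \<noteq> {}" by auto
  show lower: "n x \<le> m (x + t *\<^sub>R y) - t * m y" if "t \<ge> 0" for t x
    unfolding n_def by (rule cINF_lower[OF bdd]) (use that in simp)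
  have greatest: "c \<le> n x" if "\<And>t. t \<ge> 0 \<Longrightarrow> c \<le> m (x + t *\<^sub>R y) - t * m y" for c x
    unfolding n_def by (rule cINF_greatest[OF ne]) (use that in simp)
  show "sublinear_functional n"
    unfolding sublinear_functional_def
  proof (intro conjI allI impI)
    fix a b
    have *: "n (a + b) \<le> (m (a + s *\<^sub>R y) - s * m y) + (m (b + t *\<^sub>R y) - t * m y)"
      if "s \<ge> 0" "t \<ge> 0" for s t
    proof -
      have "n (a + b) \<le> m ((a + s *\<^sub>R y) + (b + t *\<^sub>R y)) - (s + t) * m y"
        using lower[of "s + t" "a + b"] that by (simp add: algebra_simps)
      then show ?thesis
        using sublinear_functional_add[OF m, of "a + s *\<^sub>R y" "b + t *\<^sub>R y"]
        by (simp add: algebra_simps)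
    qed
    have "n (a + b) - (m (a + s *\<^sub>R y) - s * m y) \<le> n b" if "s \<ge> 0" for s
      by (rule greatest) (use *[OF that] in \<open>simp add: algebra_simps\<close>)
    then have "n (a + b) - n b \<le> n a"
      by (intro greatest) (simp add: algebra_simps)
    then show "n (a + b) \<le> n a + n b" by simp
  next
    fix r :: real and x assume r: "r > 0"
    have hom: "m (r *\<^sub>R x + (r * t) *\<^sub>R y) = r * m (x + t *\<^sub>R y)" for t
      using scale[of r "x + t *\<^sub>R y"] r by (simp add: algebra_simps)
    show "n (r *\<^sub>R x) = r * n x"
    proof (rule antisym)
      have "n (r *\<^sub>R x) / r \<le> n x"
      proof (rule greatest)
        fix t :: real assume t: "t \<ge> 0"
        show "n (r *\<^sub>R x) / r \<le> m (x + t *\<^sub>R y) - t * m y"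
          using lower[of "r * t" "r *\<^sub>R x"] r t hom[of t] by (simp add: field_simps)
      qed
      then show "n (r *\<^sub>R x) \<le> r * n x" using r by (simp add: field_simps)
    next
      show "r * n x \<le> n (r *\<^sub>R x)"
      proof (rule greatest)
        fix t :: real assume t: "t \<ge> 0"
        have "n x \<le> m (x + (t / r) *\<^sub>R y) - (t / r) * m y" using lower[of "t / r" x] r t by simp
        then have "r * n x \<le> r * m (x + (t / r) *\<^sub>R y) - t * m y"
          using r by (simp add: field_simps)
        then show "r * n x \<le> m (r *\<^sub>R x + t *\<^sub>R y) - t * m y" using hom[of "t / r"] r by simp
      qed
    qed
  qed
qed

text \<open>
  The Hahn-Banach theorem: a minimal sublinear functional below \<open>q\<close> is additive, hence linear. Partial
  functionals and extensions are avoided, since Zorn's lemma is applied to total functions only.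
\<close>

theorem sublinear_functional_linear_minorant:
  assumes q: "sublinear_functional (q :: 'a::real_vector \<Rightarrow> real)"
  obtains \<psi> where "linear \<psi>" and "\<And>x. \<psi> x \<le> q x"
proof -
  define A where "A = {m. sublinear_functional m \<and> m \<le> q}"
  have "\<exists>m\<in>A. \<forall>a\<in>A. a \<le> m \<longrightarrow> a = m"
  proof (rule predicate_Zorn)
    show "partial_order_on A (relation_of (\<lambda>m a. a \<le> m) A)"
      by (rule partial_order_on_relation_ofI) auto
  next
    fix C assume C: "C \<in> Chains (relation_of (\<lambda>m a. a \<le> m) A)"
    then have CA: "C \<subseteq> A" and tot: "\<And>m m'. m \<in> C \<Longrightarrow> m' \<in> C \<Longrightarrow> m \<le> m' \<or> m' \<le> m"
      by (auto simp: Chains_def relation_of_def)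
    show "\<exists>u\<in>A. \<forall>a\<in>C. u \<le> a"
    proof (cases "C = {}")
      case True
      then show ?thesis using q by (auto simp: A_def)
    next
      case False
      have sub: "\<And>m. m \<in> C \<Longrightarrow> sublinear_functional m" and le: "\<And>m. m \<in> C \<Longrightarrow> m \<le> q"
        using CA by (auto simp: A_def)
      define u where "u = (\<lambda>x. INF m\<in>C. m x)"
      have u: "sublinear_functional u" and lower: "\<And>m. m \<in> C \<Longrightarrow> u \<le> m"
        using sublinear_functional_INF_chain[OF False sub le tot] by (auto simp: u_def le_fun_def)
      obtain m where "m \<in> C" using False by auto
      then have "u \<le> q" using lower le order_trans by blast
      then show ?thesis using u lower by (auto simp: A_def)
    qed
  qed
  then obtain m where "m \<in> A" and min: "\<And>a. a \<in> A \<Longrightarrow> a \<le> m \<Longrightarrow> a = m" by blast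
  then have m: "sublinear_functional m" and mq: "m \<le> q" by (auto simp: A_def)
  have superadd: "m x + m y \<le> m (x + y)" for x y
  proof -
    define n where "n = (\<lambda>x. INF t\<in>{0..}. m (x + t *\<^sub>R y) - t * m y)"
    have n: "sublinear_functional n" and low: "\<And>t x. t \<ge> 0 \<Longrightarrow> n x \<le> m (x + t *\<^sub>R y) - t * m y"
      using sublinear_functional_INF_ray[OF m, where y = y] by (auto simp: n_def)
    have "n \<le> m" using low[of 0] by (simp add: le_fun_def)
    moreover have "n \<in> A" using n \<open>n \<le> m\<close> mq by (auto simp: A_def)
    ultimately have "n = m" using min by blast
    then show ?thesis using low[of 1 x] by simp
  qed
  have add: "m (x + y) = m x + m y" for x y
    using superadd[of x y] sublinear_functional_add[OF m, of x y] by linarith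
  have neg: "m (- x) = - m x" for x
    using add[of x "- x"] sublinear_functional_zero[OF m] by simp
  have "m (t *\<^sub>R x) = t * m x" for t x
  proof (cases t "0::real" rule: linorder_cases)
    case less
    then show ?thesis
      using sublinear_functional_scale[OF m, of "- t" x] neg[of "t *\<^sub>R x"] by simp
  next
    case equal
    then show ?thesis using sublinear_functional_zero[OF m] by simp
  next
    case greater
    then show ?thesis by (rule sublinear_functional_scale[OF m])
  qed
  with add have "linear m" by (intro linearI) auto
  then show ?thesis using that mq by (auto simp: le_fun_def)
qed

text \<open>
  Each \<open>(w, r) \<in> C\<close> is a demand \<open>\<psi> w \<le> r\<close>. The smallest sublinear functional compatible with all demands,
  \<open>q w = inf {r / t | t > 0, (t w, r) \<in> C}\<close>, is finite from above by \<open>absorb\<close> and from below because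
  demands on \<open>w\<close> and \<open>- w\<close> combine to a demand at \<open>0\<close>, which is consistent by \<open>above\<close>.
\<close>

theorem convex_linear_minorant:
  fixes C :: "('a::real_vector \<times> real) set"
  assumes conv: "convex C" and above: "\<And>r. (0, r) \<in> C \<Longrightarrow> r \<ge> 0"
    and absorb: "\<And>w. \<exists>t>0. \<exists>r. (t *\<^sub>R w, r) \<in> C"
  obtains \<psi> where "linear \<psi>" and "\<And>w r. (w, r) \<in> C \<Longrightarrow> \<psi> w \<le> r"
proof -
  define Q where "Q w = {r / t |t r. t > 0 \<and> (t *\<^sub>R w, r) \<in> C}" for w
  define q where "q w = Inf (Q w)" for w
  have QI: "r / t \<in> Q w" if "t > 0" "(t *\<^sub>R w, r) \<in> C" for r t w
    using that by (auto simp: Q_def)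
  have QE: "\<exists>t>0. (t *\<^sub>R w, a * t) \<in> C" if a: "a \<in> Q w" for a w
  proof -
    obtain r t where *: "a = r / t" "t > 0" "(t *\<^sub>R w, r) \<in> C" using a by (auto simp: Q_def)
    then have "a * t = r" by simp
    then show ?thesis using * by auto
  qed
  have ne: "Q w \<noteq> {}" for w using absorb[of w] by (auto simp: Q_def)
  have sum: "a + b \<in> Q (v + w)" if ab: "a \<in> Q v" "b \<in> Q w" for a b v w
  proof -
    obtain s t where s: "s > 0" "(s *\<^sub>R v, a * s) \<in> C" and t: "t > 0" "(t *\<^sub>R w, b * t) \<in> C"
      using ab QE by metis
    \<comment> \<open>The convex combination of the two demands in which \<open>v\<close> and \<open>w\<close> get the same coefficient.\<close>
    let ?l = "s * t / (s + t)"
    have "(t / (s + t)) *\<^sub>R (s *\<^sub>R v, a * s) + (s / (s + t)) *\<^sub>R (t *\<^sub>R w, b * t) \<in> C"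
    proof (intro convexD[OF conv] s(2) t(2))
      have "t / (s + t) + s / (s + t) = (t + s) / (s + t)" by (rule add_divide_distrib[symmetric])
      then show "t / (s + t) + s / (s + t) = 1" using s(1) t(1) by (simp add: add.commute)
    qed (use s t in auto)
    also have "(t / (s + t)) *\<^sub>R (s *\<^sub>R v, a * s) + (s / (s + t)) *\<^sub>R (t *\<^sub>R w, b * t)
        = (?l *\<^sub>R (v + w), (a + b) * ?l)"
      by (simp add: algebra_simps add_divide_distrib)
    finally have "(a + b) * ?l / ?l \<in> Q (v + w)" using s t by (intro QI) auto
    then show ?thesis using s t by simp
  qed
  have bdd: "bdd_below (Q w)" for w
  proof -
    obtain b where b: "b \<in> Q (- w)" using ne[of "- w"] by auto
    have "- b \<le> a" if "a \<in> Q w" for a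
    proof -
      have "a + b \<in> Q 0" using sum[OF that b] by simp
      then obtain t r where "t > 0" "(0, r) \<in> C" "a + b = r / t" by (auto simp: Q_def)
      then have "a + b \<ge> 0" using above by simp
      then show ?thesis by simp
    qed
    then show ?thesis by (rule bdd_belowI)
  qed
  have "sublinear_functional q"
    unfolding sublinear_functional_def
  proof (intro conjI allI impI)
    fix v w
    have *: "q (v + w) \<le> a + b" if "a \<in> Q v" "b \<in> Q w" for a b
      unfolding q_def by (rule cInf_lower[OF sum[OF that] bdd])
    have "q (v + w) - a \<le> q w" if "a \<in> Q v" for a
      unfolding q_def[of w] by (rule cInf_greatest[OF ne]) (use *[OF that] in \<open>simp add: algebra_simps\<close>)
    then have "q (v + w) - q w \<le> q v"
      unfolding q_def[of v] by (intro cInf_greatest[OF ne]) (simp add: algebra_simps)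
    then show "q (v + w) \<le> q v + q w" by simp
  next
    fix u :: real and w assume u: "u > 0"
    have mem: "a * u \<in> Q (u *\<^sub>R w)" if au: "a \<in> Q w" "u > 0" for a u w
    proof -
      obtain t where t: "t > 0" "(t *\<^sub>R w, a * t) \<in> C" using QE[OF au(1)] by blast
      then have "a * t / (t / u) \<in> Q (u *\<^sub>R w)" using that(2) by (intro QI) auto
      then show ?thesis using t that(2) by simp
    qed
    have le: "q (u *\<^sub>R w) \<le> u * q w" if "u > 0" for u w
    proof -
      have "q (u *\<^sub>R w) / u \<le> q w"
        unfolding q_def[of w]
      proof (rule cInf_greatest[OF ne])
        fix a assume "a \<in> Q w"
        then have "q (u *\<^sub>R w) \<le> a * u" unfolding q_def by (intro cInf_lower mem bdd that)
        then show "q (u *\<^sub>R w) / u \<le> a" using that by (simp add: field_simps)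
      qed
      then show ?thesis using that by (simp add: field_simps)
    qed
    have "q w \<le> inverse u * q (u *\<^sub>R w)" using le[of "inverse u" "u *\<^sub>R w"] u by simp
    then have "u * q w \<le> q (u *\<^sub>R w)" using u by (simp add: field_simps)
    then show "q (u *\<^sub>R w) = u * q w" using le[OF u, of w] by simp
  qed
  then obtain \<psi> where \<psi>: "linear \<psi>" "\<And>w. \<psi> w \<le> q w"
    using sublinear_functional_linear_minorant by blast
  have "\<psi> w \<le> r" if "(w, r) \<in> C" for w r
  proof -
    have "r \<in> Q w" using QI[of 1 w r] that by simp
    then have "q w \<le> r" unfolding q_def by (rule cInf_lower[OF _ bdd])
    then show ?thesis using \<psi>(2)[of w] by simp
  qed
  then show ?thesis using that \<psi>(1) by blast
qed

section \<open>Separation in locally convex spaces\<close>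

lemma tendsto_scaleR_lcs:
  fixes g :: "'b \<Rightarrow> 'a::locally_convex_space"
  assumes "(c \<longlongrightarrow> k) F" and "(g \<longlongrightarrow> a) F"
  shows "((\<lambda>x. c x *\<^sub>R g x) \<longlongrightarrow> k *\<^sub>R a) F"
  using filterlim_compose[OF tendsto_scaleR_Pair filterlim_Pair[OF assms]] by simp

lemma continuous_on_scaleR_lcs:
  fixes g :: "'b::topological_space \<Rightarrow> 'a::locally_convex_space"
  assumes "continuous_on S c" and "continuous_on S g"
  shows "continuous_on S (\<lambda>x. c x *\<^sub>R g x)"
  using assms unfolding continuous_on_def by (auto intro: tendsto_scaleR_lcs)

lemma open_Collect_mem:
  assumes "open U" and "continuous_on UNIV g"
  shows "open {x. g x \<in> U}"
  using open_vimage[OF assms] by (simp add: vimage_def)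

lemma open_absorbing:
  fixes V :: "'a::locally_convex_space set"
  assumes "open V" and "0 \<in> V"
  obtains t where "t > 0" and "t *\<^sub>R w \<in> V"
proof -
  have "((\<lambda>t. t *\<^sub>R w) \<longlongrightarrow> 0 *\<^sub>R w) (at_right 0)"
    by (intro tendsto_scaleR_lcs tendsto_ident_at tendsto_const)
  then have "eventually (\<lambda>t. t *\<^sub>R w \<in> V) (at_right 0)"
    using assms by (auto dest: topological_tendstoD)
  moreover have "eventually (\<lambda>t::real. t > 0) (at_right 0)" by (rule eventually_at_right_less)
  ultimately have "eventually (\<lambda>t. t > 0 \<and> t *\<^sub>R w \<in> V) (at_right 0)" by eventually_elim simp
  then obtain t where "t > 0 \<and> t *\<^sub>R w \<in> V"
    using eventually_happens'[OF trivial_limit_at_right_real] by blast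
  then show ?thesis using that by blast
qed

lemma linear_bounded_above_imp_dual:
  fixes \<psi> :: "'a::locally_convex_space \<Rightarrow> real"
  assumes lin: "linear \<psi>" and V: "open V" "0 \<in> V" and le: "\<And>v. v \<in> V \<Longrightarrow> \<psi> v \<le> M"
  shows "\<psi> \<in> topological_dual"
proof -
  interpret linear \<psi> by (rule lin)
  define K where "K = max M 1"
  have K: "K > 0" "\<And>v. v \<in> V \<Longrightarrow> \<psi> v \<le> K" using le by (force simp: K_def)+
  have "(\<psi> \<longlongrightarrow> \<psi> a) (at a)" for a
  proof (rule tendstoI)
    fix e :: real assume e: "e > 0"
    define N where "N = {y. (2 * K / e) *\<^sub>R (y - a) \<in> V} \<inter> {y. - (2 * K / e) *\<^sub>R (y - a) \<in> V}"
    have "open N"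
      unfolding N_def
      by (intro open_Int open_Collect_mem V continuous_on_scaleR_lcs continuous_on_const
          continuous_on_diff continuous_on_id)
    moreover have "a \<in> N" using V by (simp add: N_def)
    ultimately have "eventually (\<lambda>y. y \<in> N) (at a)"
      by (auto simp: eventually_at_topological)
    then show "eventually (\<lambda>y. dist (\<psi> y) (\<psi> a) < e) (at a)"
    proof eventually_elim
      case (elim y)
      have "(2 * K / e) * (\<psi> y - \<psi> a) \<le> K" "- (2 * K / e) * (\<psi> y - \<psi> a) \<le> K"
        using K(2)[of "(2 * K / e) *\<^sub>R (y - a)"] K(2)[of "- (2 * K / e) *\<^sub>R (y - a)"] elim
        by (auto simp: N_def scale diff neg)
      then have "K * (2 * (\<psi> y - \<psi> a)) \<le> K * e" "K * (- (2 * (\<psi> y - \<psi> a))) \<le> K * e"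
        using K(1) e by (auto simp: field_simps)
      then have "2 * (\<psi> y - \<psi> a) \<le> e" "- (2 * (\<psi> y - \<psi> a)) \<le> e"
        using K(1) by (auto simp only: mult_le_cancel_left_pos)
      then show ?case using e by (simp add: dist_real_def)
    qed
  qed
  then show ?thesis
    using lin by (simp add: topological_dual_def continuous_on_def)
qed

lemma dual_linear: "\<psi> \<in> topological_dual \<Longrightarrow> linear \<psi>"
  by (simp add: topological_dual_def)

text \<open>
  If one constant bounds the functional on a whole neighbourhood of the origin, continuity is automatic.
\<close>

theorem continuous_linear_minorant:
  fixes C :: "('a::locally_convex_space \<times> real) set"
  assumes conv: "convex C" and above: "\<And>r. (0, r) \<in> C \<Longrightarrow> r \<ge> 0"
    and V: "open V" "0 \<in> V" and VC: "\<And>v. v \<in> V \<Longrightarrow> (v, M) \<in> C"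
  obtains \<psi> where "\<psi> \<in> topological_dual" and "\<And>w r. (w, r) \<in> C \<Longrightarrow> \<psi> w \<le> r"
proof -
  have "\<exists>t>0. \<exists>r. (t *\<^sub>R w, r) \<in> C" for w
    using open_absorbing[OF V, of w] VC by metis
  from convex_linear_minorant[OF conv above this]
  obtain \<psi> where lin: "linear \<psi>" and \<psi>: "\<And>w r. (w, r) \<in> C \<Longrightarrow> \<psi> w \<le> r" by blast
  have "\<psi> \<in> topological_dual"
    by (rule linear_bounded_above_imp_dual[OF lin V]) (rule \<psi>[OF VC])
  with \<psi> show ?thesis using that by blast
qed

text \<open>
  The tube lemma for the compact set of parameters \<open>{0..S}\<close>, with the tube shrunk to a convex one.
\<close>

lemma segment_tube:
  fixes x h :: "'a::locally_convex_space" and P :: "real \<Rightarrow> 'a \<Rightarrow> bool"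
  assumes local: "\<And>s. s \<in> {0..S} \<Longrightarrow> \<exists>I W. open I \<and> s \<in> I \<and> open W \<and> 0 \<in> W \<and> (\<forall>s'\<in>I. \<forall>v\<in>W. P s' v)"
  shows "\<exists>V. open V \<and> 0 \<in> V \<and> convex V \<and> (\<forall>s\<in>{0..S}. \<forall>v\<in>V. P s v)"
proof -
  obtain I W where IW: "\<And>s. s \<in> {0..S} \<Longrightarrow>
      open (I s) \<and> s \<in> I s \<and> open (W s) \<and> 0 \<in> W s \<and> (\<forall>s'\<in>I s. \<forall>v\<in>W s. P s' v)"
    using local by metis
  obtain D where D: "D \<subseteq> {0..S}" "finite D" "{0..S} \<subseteq> (\<Union>s\<in>D. I s)"
    by (rule compactE_image[of "{0..S}" "{0..S}" I]) (use IW in auto)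
  have "open (\<Inter>s\<in>D. W s)" "0 \<in> (\<Inter>s\<in>D. W s)" using D IW by (auto intro!: open_INT)
  from convex_nhds_base_0[OF this]
  obtain V where V: "open V" "0 \<in> V" "V \<subseteq> (\<Inter>s\<in>D. W s)" "convex V" by (auto simp: convex_def)
  have "P s v" if sv: "s \<in> {0..S}" "v \<in> V" for s v
  proof -
    obtain d where "d \<in> D" "s \<in> I d" using D(3) sv(1) by blast
    then show ?thesis using IW[of d] D(1) V(3) sv(2) by blast
  qed
  then show ?thesis using V by blast
qed

text \<open>
  For an epigraph \<open>E\<close>, the hypothesis \<open>local\<close> says that the lower semicontinuous hull of the function lies
  strictly above the segment from \<open>(x, b)\<close> to \<open>(x + S h, b + S c)\<close>. By compactness the segment can be
  thickened by a neighbourhood of the origin without losing the inequality, and the differences between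
  points of \<open>E\<close> and of the thickened segment are the demands to which \<open>continuous_linear_minorant\<close> applies.
  The point \<open>(x, r\<^sub>0)\<close> and the thickened foot of the segment bound the functional near the origin.
\<close>

theorem separate_segment_below_convex:
  fixes E :: "('a::locally_convex_space \<times> real) set" and x h :: 'a
  assumes conv: "convex E" and x: "(x, r\<^sub>0) \<in> E" and S: "S \<ge> 0"
    and local: "\<And>s. s \<in> {0..S} \<Longrightarrow> \<exists>U m. open U \<and> x + s *\<^sub>R h \<in> U \<and> b + s * c < m \<and>
                  (\<forall>y\<in>U. \<forall>r. (y, r) \<in> E \<longrightarrow> m \<le> r)"
  obtains \<psi> where "\<psi> \<in> topological_dual"
    and "\<And>y r s. (y, r) \<in> E \<Longrightarrow> s \<in> {0..S} \<Longrightarrow> b + s * c + \<psi> y \<le> r + \<psi> x + s * \<psi> h"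
proof -
  have "\<exists>I W. open I \<and> s \<in> I \<and> open W \<and> 0 \<in> W \<and>
        (\<forall>s'\<in>I. \<forall>v\<in>W. \<forall>r. (x + s' *\<^sub>R h + v, r) \<in> E \<longrightarrow> b + s' * c \<le> r)"
    if s: "s \<in> {0..S}" for s
  proof -
    obtain U m where U: "open U" "x + s *\<^sub>R h \<in> U" "b + s * c < m"
      "\<forall>y\<in>U. \<forall>r. (y, r) \<in> E \<longrightarrow> m \<le> r" using local[OF s] by blast
    define G where "G = {p. x + fst p *\<^sub>R h + snd p \<in> U} \<inter> {p. b + fst p * c \<in> {..<m}}"
    have "open G"
      unfolding G_def
    proof (rule open_Int)
      have "continuous_on UNIV (\<lambda>p. x + fst p *\<^sub>R h + snd p)"
        by (rule continuous_on_add[OF continuous_on_add[OF continuous_on_const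
            continuous_on_scaleR_lcs[OF continuous_on_fst continuous_on_const]] continuous_on_snd])
          (rule continuous_on_id)+
      then show "open {p. x + fst p *\<^sub>R h + snd p \<in> U}" by (rule open_Collect_mem[OF U(1)])
      have "continuous_on UNIV (\<lambda>p :: real \<times> 'a. b + fst p * c)" by (intro continuous_intros)
      then show "open {p :: real \<times> 'a. b + fst p * c \<in> {..<m}}" by (rule open_Collect_mem[OF open_lessThan])
    qed
    moreover have "(s, 0) \<in> G" using U by (simp add: G_def)
    ultimately obtain I W where IW: "open I" "open W" "(s, 0) \<in> I \<times> W" "I \<times> W \<subseteq> G"
      by (rule open_prod_elim)
    have "b + s' * c \<le> r" if "s' \<in> I" "v \<in> W" "(x + s' *\<^sub>R h + v, r) \<in> E" for s' v r
    proof -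
      have "(s', v) \<in> G" using IW(4) that by blast
      then have "b + s' * c < m" "x + s' *\<^sub>R h + v \<in> U" by (auto simp: G_def)
      then show ?thesis using U(4) that(3) by (meson less_imp_le order_trans)
    qed
    with IW show ?thesis by (intro exI[of _ I] exI[of _ W]) blast
  qed
  note tube_local = this
  define P where "P s v \<longleftrightarrow> (\<forall>r. (x + s *\<^sub>R h + v, r) \<in> E \<longrightarrow> b + s * c \<le> r)" for s v
  obtain V where V: "open V" "0 \<in> V" "convex V" and VP: "\<forall>s\<in>{0..S}. \<forall>v\<in>V. P s v"
    using segment_tube[of S P, OF tube_local[folded P_def]] by blast
  have tube: "b + s * c \<le> r" if "s \<in> {0..S}" "v \<in> V" "(x + s *\<^sub>R h + v, r) \<in> E" for s v r
    using VP that by (simp add: P_def)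
  define B where "B = {(x + s *\<^sub>R h + v, b + s * c) | s v. s \<in> {0..S} \<and> v \<in> V}"
  define C where "C = {p - q | p q. p \<in> E \<and> q \<in> B}"
  have "convex B"
  proof (rule convexI)
    fix p q :: "'a \<times> real" and u w :: real assume pq: "p \<in> B" "q \<in> B" and uw: "0 \<le> u" "0 \<le> w" "u + w = 1"
    obtain s v where p: "p = (x + s *\<^sub>R h + v, b + s * c)" "s \<in> {0..S}" "v \<in> V"
      using pq(1) by (auto simp: B_def)
    obtain s' v' where q: "q = (x + s' *\<^sub>R h + v', b + s' * c)" "s' \<in> {0..S}" "v' \<in> V"
      using pq(2) by (auto simp: B_def)
    have "u * s + w * s' \<in> {0..S}"
      using convexD[OF convex_real_interval(5), of s 0 S s' u w] p(2) q(2) uw by simp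
    moreover have "u *\<^sub>R v + w *\<^sub>R v' \<in> V" using convexD[OF V(3)] p(3) q(3) uw by blast
    moreover have "u *\<^sub>R p + w *\<^sub>R q =
      ((u + w) *\<^sub>R x + (u * s + w * s') *\<^sub>R h + (u *\<^sub>R v + w *\<^sub>R v'), (u + w) * b + (u * s + w * s') * c)"
      unfolding p(1) q(1) by (simp add: algebra_simps)
    ultimately show "u *\<^sub>R p + w *\<^sub>R q \<in> B" unfolding uw(3) by (auto simp: B_def)
  qed
  with conv have "convex (\<Union>p\<in>E. \<Union>q\<in>B. {p - q})" by (rule convex_differences)
  also have "(\<Union>p\<in>E. \<Union>q\<in>B. {p - q}) = C" unfolding C_def by blast
  finally have "convex C" .
  moreover have "r \<ge> 0" if r: "(0, r) \<in> C" for r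
  proof -
    obtain p q where pq: "(0, r) = p - q" "p \<in> E" "q \<in> B" using r unfolding C_def by blast
    obtain s v where q: "q = (x + s *\<^sub>R h + v, b + s * c)" "s \<in> {0..S}" "v \<in> V"
      using pq(3) unfolding B_def by blast
    have "p = (x + s *\<^sub>R h + v, r + (b + s * c))" using pq(1) q(1) by (simp add: prod_eq_iff)
    then show ?thesis using tube[OF q(2,3)] pq(2) by fastforce
  qed
  moreover have "open {v. - v \<in> V}" by (intro open_Collect_mem V continuous_on_minus continuous_on_id)
  moreover have "0 \<in> {v. - v \<in> V}" using V by simp
  moreover have "(v, r\<^sub>0 - b) \<in> C" if "v \<in> {v. - v \<in> V}" for v
  proof -
    have "(x + 0 *\<^sub>R h + - v, b + 0 * c) \<in> B" using that S unfolding B_def mem_Collect_eq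
      by (intro exI[of _ 0] exI[of _ "- v"]) simp
    moreover have "(v, r\<^sub>0 - b) = (x, r\<^sub>0) - (x + 0 *\<^sub>R h + - v, b + 0 * c)" by simp
    ultimately show ?thesis using x unfolding C_def by blast
  qed
  ultimately obtain \<psi> where dual: "\<psi> \<in> topological_dual" and \<psi>: "\<And>w r. (w, r) \<in> C \<Longrightarrow> \<psi> w \<le> r"
    using continuous_linear_minorant[of C "{v. - v \<in> V}" "r\<^sub>0 - b"] by blast
  interpret linear \<psi> by (rule dual_linear[OF dual])
  have "b + s * c + \<psi> y \<le> r + \<psi> x + s * \<psi> h" if "(y, r) \<in> E" "s \<in> {0..S}" for y r s
  proof -
    have "(x + s *\<^sub>R h + 0, b + s * c) \<in> B" using that V unfolding B_def by blast
    then have "(y, r) - (x + s *\<^sub>R h + 0, b + s * c) \<in> C" using that unfolding C_def by blast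
    then have "\<psi> (y - (x + s *\<^sub>R h)) \<le> r - (b + s * c)" using \<psi> by simp
    then show ?thesis by (simp add: diff add scale)
  qed
  then show ?thesis using that dual by blast
qed

section \<open>Separation in the weak* topology\<close>

text \<open>
  Separation in the dual is obtained from a linear functional on the space of all real functions, which
  therefore has to be a vector space.
\<close>

instantiation "fun" :: (type, real_vector) real_vector
begin

definition scaleR_fun :: "real \<Rightarrow> ('a \<Rightarrow> 'b) \<Rightarrow> 'a \<Rightarrow> 'b" where
  "scaleR_fun r f = (\<lambda>x. r *\<^sub>R f x)"

instance
  by standard (auto simp: scaleR_fun_def fun_eq_iff algebra_simps)

end

lemma scaleR_fun_apply [simp]: "(r *\<^sub>R f) x = r *\<^sub>R f x"
  by (simp add: scaleR_fun_def)

lemma topspace_weak_star [simp]: "topspace weak_star_topology = topological_dual"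
  by (simp add: weak_star_topology_def)

text \<open>
  Evaluation at a point is weak* continuous, so its sublevel sets are closed.
\<close>

lemma weak_star_closure_le:
  assumes "\<phi> \<in> weak_star_topology closure_of A" and "\<And>\<psi>. \<psi> \<in> A \<Longrightarrow> \<psi> y \<le> r"
  shows "\<phi> y \<le> r"
proof (rule ccontr)
  assume "\<not> \<phi> y \<le> r"
  define U :: "('a \<Rightarrow> real) set" where "U = {g. g y \<in> {r<..}}"
  have "openin (powertop_real UNIV) U"
    using openin_continuous_map_preimage[OF continuous_map_product_projection[of y UNIV "\<lambda>_. euclideanreal"], of "{r<..}"]
    by (simp add: U_def)
  then have "openin weak_star_topology (U \<inter> topological_dual)"
    unfolding weak_star_topology_def by (metis openin_subtopology)
  moreover have "\<phi> \<in> U \<inter> topological_dual"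
    using assms(1) \<open>\<not> \<phi> y \<le> r\<close> by (auto simp: in_closure_of U_def)
  ultimately obtain \<psi> where "\<psi> \<in> A" "\<psi> \<in> U" using assms(1) unfolding in_closure_of by blast
  then show False using assms(2)[of \<psi>] by (simp add: U_def)
qed

lemma not_in_weak_star_closureE:
  assumes "\<phi> \<in> topological_dual" and A: "A \<subseteq> topological_dual"
    and "\<phi> \<notin> weak_star_topology closure_of A"
  obtains H e where "finite H" and "e > 0" and "\<And>\<psi>. \<psi> \<in> A \<Longrightarrow> \<exists>i\<in>H. e \<le> \<bar>\<psi> i - \<phi> i\<bar>"
proof -
  obtain W where W: "openin weak_star_topology W" "\<phi> \<in> W" "W \<inter> A = {}"
    using assms unfolding in_closure_of topspace_weak_star by blast
  then obtain W' where W': "openin (powertop_real UNIV) W'" "W = W' \<inter> topological_dual"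
    unfolding weak_star_topology_def openin_subtopology by blast
  obtain X where X: "\<phi> \<in> (\<Pi>\<^sub>E i\<in>UNIV. X i)" "\<And>i. open (X i)"
    "finite {i. X i \<noteq> UNIV}" "(\<Pi>\<^sub>E i\<in>UNIV. X i) \<subseteq> W'"
    using product_topology_open_contains_basis[OF W'(1), of \<phi>] W(2) W'(2) by auto
  define H where "H = {i. X i \<noteq> UNIV}"
  have "\<exists>e>0. ball (\<phi> i) e \<subseteq> X i" for i
    using X(1,2) by (auto simp: PiE_iff open_contains_ball)
  then obtain e where e: "\<And>i. e i > 0" "\<And>i. ball (\<phi> i) (e i) \<subseteq> X i" by metis
  define d where "d = Min (insert 1 (e ` H))"
  have H: "finite H" using X(3) by (simp add: H_def)
  have d: "d > 0" "\<And>i. i \<in> H \<Longrightarrow> d \<le> e i" using H e(1) by (auto simp: d_def)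
  have "\<exists>i\<in>H. d \<le> \<bar>\<psi> i - \<phi> i\<bar>" if \<psi>: "\<psi> \<in> A" for \<psi>
  proof (rule ccontr)
    assume "\<not> ?thesis"
    then have close: "\<bar>\<psi> i - \<phi> i\<bar> < d" if "i \<in> H" for i using that by force
    have "\<psi> i \<in> X i" for i
    proof (cases "i \<in> H")
      case True
      then have "\<psi> i \<in> ball (\<phi> i) (e i)" using close[of i] d(2)[of i] by (auto simp: dist_real_def)
      then show ?thesis using e(2) by blast
    qed (simp add: H_def)
    then have "\<psi> \<in> W'" using X(4) by (auto simp: PiE_iff)
    then show False using W(3) W'(2) \<psi> A by blast
  qed
  then show ?thesis using that H d(1) by blast
qed

text \<open>
  Only finitely many points \<open>i \<in> H\<close> witness that \<open>\<phi>\<close> is not in the closure. A functional \<open>\<Lambda>\<close> that is at most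
  \<open>1\<close> on the functions that are small on \<open>H\<close> depends only on the values on \<open>H\<close>, and so on linear functions
  it is the evaluation at a combination \<open>h\<close> of these points. The demands encode both this bound and the
  separation: the multiples \<open>a (\<psi> - \<phi>)\<close> are to have value at most \<open>- a\<close>, up to the error \<open>1\<close>.
\<close>

theorem weak_star_separation:
  fixes A :: "('a::{real_vector,topological_space} \<Rightarrow> real) set"
  assumes \<phi>: "\<phi> \<in> topological_dual" and A: "A \<subseteq> topological_dual" "convex A" "A \<noteq> {}"
    and notin: "\<phi> \<notin> weak_star_topology closure_of A"
  obtains h \<eta> where "\<eta> > 0" and "\<And>\<psi>. \<psi> \<in> A \<Longrightarrow> \<psi> h \<le> \<phi> h - \<eta>"
proof -
  obtain H e where H: "finite H" and e: "e > 0"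
    and far: "\<And>\<psi>. \<psi> \<in> A \<Longrightarrow> \<exists>i\<in>H. e \<le> \<bar>\<psi> i - \<phi> i\<bar>"
    using not_in_weak_star_closureE[OF \<phi> A(1) notin] by blast
  define D where "D = {d. \<forall>i\<in>H. \<bar>d i\<bar> < e}"
  define K where "K = cone hull ((\<lambda>\<psi>. (\<psi> - \<phi>, - 1 :: real)) ` A)"
  define C where "C = {p + q | p q. p \<in> K \<and> q \<in> D \<times> {1}}"
  have K: "K = {(a *\<^sub>R (\<psi> - \<phi>), - a) | a \<psi>. a \<ge> 0 \<and> \<psi> \<in> A}"
  proof -
    have *: "(a *\<^sub>R (\<psi> - \<phi>), - a) = a *\<^sub>R (\<psi> - \<phi>, - 1 :: real)" for a and \<psi> :: "'a \<Rightarrow> real" by simp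
    show ?thesis unfolding K_def cone_hull_expl * by blast
  qed
  have "convex ((\<lambda>\<psi>. (\<psi> - \<phi>, - 1 :: real)) ` A)"
  proof -
    have "(\<lambda>\<psi>. (\<psi> - \<phi>, - 1 :: real)) ` A = (\<lambda>\<psi>. \<psi> - \<phi>) ` A \<times> {- 1}" by auto
    then show ?thesis using A(2) by (simp add: convex_Times convex_translation_subtract)
  qed
  then have "convex K" unfolding K_def by (rule convex_cone_hull)
  moreover have "convex (D \<times> {1 :: real})"
  proof (rule convex_Times)
    show "convex D"
    proof (rule convexI)
      fix f g :: "'a \<Rightarrow> real" and u v :: real
      assume fg: "f \<in> D" "g \<in> D" and uv: "0 \<le> u" "0 \<le> v" "u + v = 1"
      have "\<bar>u * f i + v * g i\<bar> < e" if "i \<in> H" for i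
      proof -
        have "f i \<in> {-e<..<e}" "g i \<in> {-e<..<e}" using fg that by (auto simp: D_def)
        then have "u *\<^sub>R f i + v *\<^sub>R g i \<in> {-e<..<e}"
          using uv by (intro convexD[OF convex_real_interval(8)])
        then show ?thesis by auto
      qed
      then show "u *\<^sub>R f + v *\<^sub>R g \<in> D" by (simp add: D_def)
    qed
  qed simp
  ultimately have "convex (\<Union>p\<in>K. \<Union>q\<in>D \<times> {1}. {p + q})" by (rule convex_sums)
  also have "(\<Union>p\<in>K. \<Union>q\<in>D \<times> {1}. {p + q}) = C" unfolding C_def by blast
  finally have convC: "convex C" .
  have memC: "(a *\<^sub>R (\<psi> - \<phi>) + d, 1 - a) \<in> C" if "a \<ge> 0" "\<psi> \<in> A" "d \<in> D" for a \<psi> d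
  proof -
    have "(a *\<^sub>R (\<psi> - \<phi>), - a) + (d, 1) \<in> C" unfolding C_def K using that by blast
    then show ?thesis by simp
  qed
  have "r \<ge> 0" if r: "(0, r) \<in> C" for r
  proof (rule ccontr)
    assume "\<not> r \<ge> 0"
    obtain a \<psi> d where *: "a \<ge> 0" "\<psi> \<in> A" "d \<in> D" "a *\<^sub>R (\<psi> - \<phi>) + d = 0" "r = 1 - a"
      using r unfolding C_def K by auto
    then have a: "a > 1" using \<open>\<not> r \<ge> 0\<close> by simp
    obtain i where i: "i \<in> H" "e \<le> \<bar>\<psi> i - \<phi> i\<bar>" using far[OF *(2)] by blast
    have "a * (\<psi> i - \<phi> i) + d i = 0" using fun_cong[OF *(4), of i] by simp
    then have "\<bar>a * (\<psi> i - \<phi> i)\<bar> = \<bar>d i\<bar>" by linarith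
    then have "\<bar>d i\<bar> = a * \<bar>\<psi> i - \<phi> i\<bar>" using a by (simp add: abs_mult)
    moreover have "a * \<bar>\<psi> i - \<phi> i\<bar> \<ge> 1 * \<bar>\<psi> i - \<phi> i\<bar>" using a by (intro mult_right_mono) auto
    moreover have "\<bar>d i\<bar> < e" using *(3) i by (simp add: D_def)
    ultimately have "\<bar>\<psi> i - \<phi> i\<bar> < e" by simp
    then show False using i(2) by simp
  qed
  moreover have "\<exists>t>0. \<exists>r. (t *\<^sub>R w, r) \<in> C" for w
  proof -
    define m where "m = Max (insert 1 ((\<lambda>i. \<bar>w i\<bar>) ` H))"
    have m: "m \<ge> 1" "\<And>i. i \<in> H \<Longrightarrow> \<bar>w i\<bar> \<le> m" using H by (auto simp: m_def)
    have "(e / (2 * m)) *\<^sub>R w \<in> D"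
      unfolding D_def
    proof (intro CollectI ballI)
      fix i assume "i \<in> H"
      then have "e * \<bar>w i\<bar> < e * (2 * m)" using m(1) m(2)[of i] e by (intro mult_strict_left_mono) auto
      then show "\<bar>((e / (2 * m)) *\<^sub>R w) i\<bar> < e"
        using m(1) e by (simp add: abs_mult divide_less_eq)
    qed
    moreover obtain \<psi> where "\<psi> \<in> A" using A(3) by blast
    ultimately have "((e / (2 * m)) *\<^sub>R w, 1) \<in> C" using memC[of 0 \<psi> "(e / (2 * m)) *\<^sub>R w"] by simp
    then show ?thesis using e m(1) by (intro exI[of _ "e / (2 * m)"]) auto
  qed
  ultimately obtain \<Lambda> where \<Lambda>: "linear \<Lambda>" and le: "\<And>w r. (w, r) \<in> C \<Longrightarrow> \<Lambda> w \<le> r"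
    using convex_linear_minorant[OF convC] by blast
  interpret linear \<Lambda> by (rule \<Lambda>)
  obtain \<psi>\<^sub>0 where \<psi>\<^sub>0: "\<psi>\<^sub>0 \<in> A" using A(3) by blast
  have vanish: "\<Lambda> g = 0" if g: "\<And>i. i \<in> H \<Longrightarrow> g i = 0" for g
  proof -
    have *: "\<Lambda> (t *\<^sub>R g) \<le> 1" for t
    proof -
      have "t *\<^sub>R g \<in> D" using g e by (simp add: D_def)
      then show ?thesis using le[OF memC[of 0 \<psi>\<^sub>0 "t *\<^sub>R g"]] \<psi>\<^sub>0 by simp
    qed
    show ?thesis
    proof (rule ccontr)
      assume "\<Lambda> g \<noteq> 0"
      then show False using *[of "2 / \<Lambda> g"] by (simp add: scale)
    qed
  qed
  define \<delta> :: "'a \<Rightarrow> 'a \<Rightarrow> real" where "\<delta> i = (\<lambda>y. if y = i then 1 else 0)" for i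
  define h where "h = (\<Sum>i\<in>H. \<Lambda> (\<delta> i) *\<^sub>R i)"
  have sum_apply: "(\<Sum>i\<in>J. F i) y = (\<Sum>i\<in>J. F i y)" for J :: "'a set" and F :: "'a \<Rightarrow> 'a \<Rightarrow> real" and y
    by (induction J rule: infinite_finite_induct) auto
  have eval: "\<Lambda> \<psi> = \<psi> h" if "linear \<psi>" for \<psi>
  proof -
    have "\<Lambda> (\<psi> - (\<Sum>i\<in>H. \<psi> i *\<^sub>R \<delta> i)) = 0"
      by (rule vanish) (simp add: sum_apply \<delta>_def H if_distrib cong: if_cong)
    then have "\<Lambda> \<psi> = (\<Sum>i\<in>H. \<psi> i * \<Lambda> (\<delta> i))" by (simp add: diff sum scale)
    also have "\<dots> = \<psi> h"
      unfolding h_def linear_sum[OF that] by (simp add: linear_scale[OF that] mult.commute)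
    finally show ?thesis .
  qed
  have "\<psi> h \<le> \<phi> h - 1 / 2" if "\<psi> \<in> A" for \<psi>
  proof -
    have "0 \<in> D" using e by (simp add: D_def)
    then have "\<Lambda> (2 *\<^sub>R (\<psi> - \<phi>)) \<le> 1 - 2" using le[OF memC[of 2 \<psi> 0]] that by simp
    moreover have "\<Lambda> \<psi> = \<psi> h" "\<Lambda> \<phi> = \<phi> h"
      using eval dual_linear A(1) \<phi> that by blast+
    ultimately have "2 * (\<psi> h - \<phi> h) \<le> - 1" by (simp add: scale diff)
    then show ?thesis by simp
  qed
  then show ?thesis using that[of "1 / 2" h] by simp
qed

section \<open>Convex functions, epigraphs and directional derivatives\<close>

definition epi :: "('a \<Rightarrow> ereal) \<Rightarrow> ('a \<times> real) set" where
  "epi f = {(y, r). f y \<le> ereal r}"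

text \<open>
  The cone generated by the epigraph of \<open>f\<close>, seen from \<open>(x, f x)\<close>. For convex \<open>f\<close> it contains \<open>(w, r)\<close> if \<open>r\<close> exceeds the
  directional derivative \<open>f'(x;w)\<close>, and only if \<open>r \<ge> f'(x;w)\<close>. Working with this convex cone instead of the
  derivative avoids infinite values.
\<close>

definition dir_epi :: "('a::real_vector \<Rightarrow> ereal) \<Rightarrow> 'a \<Rightarrow> ('a \<times> real) set" where
  "dir_epi f x = {(w, r). \<exists>s>0. f (x + s *\<^sub>R w) \<le> f x + ereal (s * r)}"

lemma convex_epi:
  assumes "convex_fun f" shows "convex (epi f)"
proof (rule convexI)
  fix p q :: "'a \<times> real" and u v :: real
  assume pq: "p \<in> epi f" "q \<in> epi f" and uv: "0 \<le> u" "0 \<le> v" "u + v = 1"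
  obtain y r z s where p: "p = (y, r)" "f y \<le> ereal r" and q: "q = (z, s)" "f z \<le> ereal s"
    using pq by (auto simp: epi_def)
  show "u *\<^sub>R p + v *\<^sub>R q \<in> epi f"
  proof (cases "u = 0 \<or> v = 0")
    case True
    then show ?thesis using uv p q by (auto simp: epi_def)
  next
    case False
    then have "f (u *\<^sub>R y + v *\<^sub>R z) \<le> ereal u * f y + ereal v * f z"
      using assms uv by (auto simp: convex_fun_def)
    also have "\<dots> \<le> ereal u * ereal r + ereal v * ereal s"
      using p q uv by (intro add_mono ereal_mult_left_mono) auto
    finally show ?thesis using p q by (simp add: epi_def)
  qed
qed

lemma convex_fun_add:
  assumes f: "convex_fun f" "\<And>y. f y > - \<infinity>" and g: "convex_fun g" "\<And>y. g y > - \<infinity>"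
  shows "convex_fun (\<lambda>y. f y + g y)"
  unfolding convex_fun_def
proof (intro allI impI)
  fix x y and u v :: real assume uv: "u > 0" "v > 0" "u + v = 1"
  have "f (u *\<^sub>R x + v *\<^sub>R y) + g (u *\<^sub>R x + v *\<^sub>R y)
      \<le> (ereal u * f x + ereal v * f y) + (ereal u * g x + ereal v * g y)"
    using f(1) g(1) uv by (intro add_mono) (auto simp: convex_fun_def)
  also have "\<dots> = ereal u * (f x + g x) + ereal v * (f y + g y)"
    using f(2)[of x] f(2)[of y] g(2)[of x] g(2)[of y] uv
    by (cases "f x"; cases "f y"; cases "g x"; cases "g y") (auto simp: algebra_simps)
  finally show "f (u *\<^sub>R x + v *\<^sub>R y) + g (u *\<^sub>R x + v *\<^sub>R y)
      \<le> ereal u * (f x + g x) + ereal v * (f y + g y)" .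
qed

lemma sum_ereal_gt_MInf:
  fixes F :: "'i \<Rightarrow> ereal"
  assumes "\<And>t. t \<in> I \<Longrightarrow> F t > - \<infinity>" shows "(\<Sum>t\<in>I. F t) > - \<infinity>"
  using assms by (induction I rule: infinite_finite_induct) auto

lemma convex_fun_sum:
  assumes "\<And>t. t \<in> I \<Longrightarrow> convex_fun (f t)" and "\<And>t y. t \<in> I \<Longrightarrow> f t y > - \<infinity>"
  shows "convex_fun (\<lambda>y. \<Sum>t\<in>I. f t y)"
  using assms
proof (induction I rule: infinite_finite_induct)
  case (insert t I)
  then show ?case by (auto intro!: convex_fun_add sum_ereal_gt_MInf)
qed (auto simp: convex_fun_def)

lemma Gamma0_gt_MInf: "f \<in> Gamma0 \<Longrightarrow> f y > - \<infinity>"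
  and Gamma0_convex: "f \<in> Gamma0 \<Longrightarrow> convex_fun f"
  by (auto simp: Gamma0_def proper_fun_def)

lemma Gamma0_lscE:
  assumes "f \<in> Gamma0" and "c < f x"
  obtains U where "open U" "x \<in> U" "\<And>y. y \<in> U \<Longrightarrow> c < f y"
proof -
  have "eventually (\<lambda>y. c < f y) (nhds x)" using assms by (simp add: Gamma0_def lower_semicont_def)
  then show ?thesis using that by (auto simp: eventually_nhds)
qed

text \<open>
  The subgradient inequality in real numbers: the values of \<open>f\<close> are replaced by their real upper bounds.
\<close>

lemma eps_subdiff_finite:
  assumes a: "f x = ereal a"
  shows "\<psi> \<in> eps_subdiff \<epsilon> f x \<longleftrightarrow>
    \<psi> \<in> topological_dual \<and> (\<forall>y r. f y \<le> ereal r \<longrightarrow> \<psi> (y - x) \<le> r - a + \<epsilon>)"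
proof -
  have "ereal (\<psi> (y - x)) \<le> f y - f x + ereal \<epsilon> \<longleftrightarrow> (\<forall>r. f y \<le> ereal r \<longrightarrow> \<psi> (y - x) \<le> r - a + \<epsilon>)" for y
  proof (cases "f y")
    case (real r)
    show ?thesis
    proof
      assume "ereal (\<psi> (y - x)) \<le> f y - f x + ereal \<epsilon>"
      then show "\<forall>r. f y \<le> ereal r \<longrightarrow> \<psi> (y - x) \<le> r - a + \<epsilon>" using real a by force
    qed (use real a in auto)
  next
    case MInf
    have "(\<forall>r. \<psi> (y - x) \<le> r - a + \<epsilon>) \<longleftrightarrow> False"
      by (auto intro!: exI[of _ "\<psi> (y - x) + a - \<epsilon> - 1"])
    then show ?thesis using MInf a by simp
  qed (use a in auto)
  then show ?thesis using a unfolding eps_subdiff_def by auto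
qed

locale convex_at =
  fixes f :: "'a::real_vector \<Rightarrow> ereal" and x :: 'a and a :: real
  assumes convex_f: "convex_fun f" and fx: "f x = ereal a"
begin

abbreviation E where "E \<equiv> dir_epi f x"

lemma dir_epi_iff: "(w, r) \<in> E \<longleftrightarrow> (\<exists>s>0. f (x + s *\<^sub>R w) \<le> ereal (a + s * r))"
  using fx by (simp add: dir_epi_def)

text \<open>
  Difference quotients of a convex function decrease with the step. Finitely many directional bounds
  can therefore be realised with a common step.
\<close>

lemma convex_fun_quotient_mono:
  assumes le: "f (x + s *\<^sub>R w) \<le> ereal (a + s * r)"
    and s: "0 < s'" "s' \<le> s"
  shows "f (x + s' *\<^sub>R w) \<le> ereal (a + s' * r)"
proof -
  have "(1 - s' / s) *\<^sub>R (x, a) + (s' / s) *\<^sub>R (x + s *\<^sub>R w, a + s * r) \<in> epi f"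
    using fx le s by (intro convexD[OF convex_epi[OF convex_f]]) (auto simp: epi_def)
  moreover have "(1 - s' / s) *\<^sub>R (x, a) + (s' / s) *\<^sub>R (x + s *\<^sub>R w, a + s * r) = (x + s' *\<^sub>R w, a + s' * r)"
    using s by (simp add: algebra_simps)
  ultimately show ?thesis by (simp add: epi_def)
qed

lemma convex_dir_epi:
  shows "convex (E)"
proof (rule convexI)
  fix p q :: "'a \<times> real" and u v :: real
  assume pq: "p \<in> E" "q \<in> E" and uv: "0 \<le> u" "0 \<le> v" "u + v = 1"
  obtain y r s where p: "p = (y, r)" "s > 0" "f (x + s *\<^sub>R y) \<le> ereal (a + s * r)"
    using pq(1) dir_epi_iff by (cases p) auto
  obtain z r' s' where q: "q = (z, r')" "s' > 0" "f (x + s' *\<^sub>R z) \<le> ereal (a + s' * r')"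
    using pq(2) dir_epi_iff by (cases q) auto
  define m where "m = min s s'"
  have m: "m > 0" "m \<le> s" "m \<le> s'" using p q by (auto simp: m_def)
  have "u *\<^sub>R (x + m *\<^sub>R y, a + m * r) + v *\<^sub>R (x + m *\<^sub>R z, a + m * r') \<in> epi f"
    using convex_fun_quotient_mono[OF p(3) m(1,2)] convex_fun_quotient_mono[OF q(3) m(1,3)] uv
    by (intro convexD[OF convex_epi[OF convex_f]]) (auto simp: epi_def)
  also have "u *\<^sub>R (x + m *\<^sub>R y, a + m * r) + v *\<^sub>R (x + m *\<^sub>R z, a + m * r') =
    ((u + v) *\<^sub>R x + m *\<^sub>R (u *\<^sub>R y + v *\<^sub>R z), (u + v) * a + m * (u * r + v * r'))"
    by (simp add: algebra_simps)
  finally show "u *\<^sub>R p + v *\<^sub>R q \<in> E"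
    using m(1) uv(3) p(1) q(1) by (auto simp: dir_epi_iff epi_def)
qed

lemma dir_epi_scale:
  assumes "(w, r) \<in> E" and c: "c > 0"
  shows "(c *\<^sub>R w, c * r) \<in> E"
proof -
  obtain s where "s > 0" "f (x + s *\<^sub>R w) \<le> ereal (a + s * r)" using assms dir_epi_iff by auto
  then show ?thesis using c unfolding dir_epi_iff by (intro exI[of _ "s / c"]) simp
qed

lemma dir_epi_add:
  assumes "(w, r) \<in> E" and "(w', r') \<in> E"
  shows "(w + w', r + r') \<in> E"
proof -
  have "(1/2) *\<^sub>R (w, r) + (1/2) *\<^sub>R (w', r') \<in> E"
    using assms by (intro convexD[OF convex_dir_epi]) auto
  then have "(2 *\<^sub>R ((1/2) *\<^sub>R w + (1/2) *\<^sub>R w'), 2 * ((1/2) * r + (1/2) * r')) \<in> E"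
    by (intro dir_epi_scale) auto
  then show ?thesis by (simp add: scaleR_add_right)
qed

lemma dir_epi_zero: "(0, r) \<in> E \<longleftrightarrow> r \<ge> 0"
proof -
  have "(0, r) \<in> E \<longleftrightarrow> (\<exists>s>0. 0 \<le> s * r)" by (simp add: dir_epi_iff fx)
  also have "\<dots> \<longleftrightarrow> r \<ge> 0" using zero_less_one by (metis mult_1 zero_le_mult_iff less_le_not_le)
  finally show ?thesis .
qed

lemma dir_epi_upward:
  assumes "(w, r) \<in> E" and "r \<le> r'"
  shows "(w, r') \<in> E"
proof -
  obtain s where s: "s > 0" "f (x + s *\<^sub>R w) \<le> ereal (a + s * r)" using assms dir_epi_iff by auto
  have "ereal (a + s * r) \<le> ereal (a + s * r')" using s(1) assms(2) by simp
  then show ?thesis using s order_trans unfolding dir_epi_iff by blast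
qed

end

locale Gamma0_at = convex_at f x a for f :: "'a::locally_convex_space \<Rightarrow> ereal" and x a +
  assumes Gamma0_f: "f \<in> Gamma0"
begin

lemmas eps_subdiff_finite_iff = eps_subdiff_finite[where f = f and x = x, OF fx]

text \<open>
  The half-line from \<open>(x, f x - \<epsilon>)\<close> in the direction \<open>(k, c)\<close> lies strictly below the graph. Separating an
  initial piece of length \<open>S\<close> from the epigraph gives an \<open>\<epsilon>\<close>-subgradient \<open>\<psi>\<close> with \<open>\<psi> k \<ge> c - \<epsilon>/S\<close>: its value at
  the foot yields the \<open>\<epsilon>\<close>-subgradient inequality and its value at the other end the estimate. The choice
  \<open>S = \<epsilon>/\<eta>\<close> makes the error equal to \<open>\<eta>\<close>.
\<close>

theorem eps_subdiff_support:
  assumes \<epsilon>: "\<epsilon> > 0" and \<eta>: "\<eta> > 0"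
    and k: "(k, c) \<notin> E"
  obtains \<psi> where "\<psi> \<in> eps_subdiff \<epsilon> f x" and "c - \<eta> \<le> \<psi> k"
proof -
  have "\<exists>U m. open U \<and> x + s *\<^sub>R k \<in> U \<and> a - \<epsilon> + s * c < m \<and> (\<forall>y\<in>U. \<forall>r. (y, r) \<in> epi f \<longrightarrow> m \<le> r)"
    if s: "s \<in> {0..\<epsilon> / \<eta>}" for s
  proof -
    \<comment> \<open>Half of \<open>\<epsilon>\<close> is given away: at \<open>s = 0\<close> the graph is higher than the segment by \<open>\<epsilon>\<close>, but not by more.\<close>
    define m where "m = a + s * c - \<epsilon> / 2"
    have "ereal m < f (x + s *\<^sub>R k)"
    proof (cases "s = 0")
      case True
      then show ?thesis using fx \<epsilon> by (simp add: m_def)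
    next
      case False
      then have "ereal (a + s * c) < f (x + s *\<^sub>R k)" using k s unfolding dir_epi_iff by (simp add: not_le)
      moreover have "ereal m < ereal (a + s * c)" using \<epsilon> by (simp add: m_def)
      ultimately show ?thesis by (rule less_trans[rotated])
    qed
    then obtain U where U: "open U" "x + s *\<^sub>R k \<in> U" "\<And>y. y \<in> U \<Longrightarrow> ereal m < f y"
      using Gamma0_lscE[OF Gamma0_f] by blast
    have "m \<le> r" if "y \<in> U" "(y, r) \<in> epi f" for y r
    proof -
      have "ereal m < ereal r"
        using that(2) by (intro less_le_trans[OF U(3)[OF that(1)]]) (simp add: epi_def)
      then show ?thesis by simp
    qed
    then show ?thesis using U(1,2) \<epsilon> by (intro exI[of _ U] exI[of _ m]) (auto simp: m_def)
  qed
  note above = this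
  have xa: "(x, a) \<in> epi f" using fx by (simp add: epi_def)
  have S: "\<epsilon> / \<eta> \<ge> 0" using \<epsilon> \<eta> by simp
  obtain \<psi> where dual: "\<psi> \<in> topological_dual" and
    \<psi>: "\<And>y r s. (y, r) \<in> epi f \<Longrightarrow> s \<in> {0..\<epsilon> / \<eta>} \<Longrightarrow> a - \<epsilon> + s * c + \<psi> y \<le> r + \<psi> x + s * \<psi> k"
    using separate_segment_below_convex[OF convex_epi[OF convex_f] xa S above] by blast
  interpret linear \<psi> by (rule dual_linear[OF dual])
  have "\<psi> (y - x) \<le> r - a + \<epsilon>" if "f y \<le> ereal r" for y r
    using \<psi>[of y r 0] that \<epsilon> \<eta> by (simp add: epi_def diff)
  then have "\<psi> \<in> eps_subdiff \<epsilon> f x" using dual eps_subdiff_finite_iff by blast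
  moreover have "\<epsilon> / \<eta> * (c - \<psi> k) \<le> \<epsilon>"
    using \<psi>[of x a "\<epsilon> / \<eta>"] \<epsilon> \<eta> fx by (simp add: epi_def algebra_simps)
  then have "\<epsilon> * (c - \<psi> k) \<le> \<epsilon> * \<eta>" using \<eta> by (simp add: field_simps)
  then have "c - \<psi> k \<le> \<eta>" using \<epsilon> by (simp only: mult_le_cancel_left_pos)
  then have "c - \<eta> \<le> \<psi> k" by simp
  ultimately show ?thesis using that by blast
qed

end

section \<open>Directional derivatives under relative continuity\<close>

text \<open>
  The situation of an index in \<open>T\<^sub>0\<close>: \<open>f\<close> is bounded above near \<open>x\<^sub>0\<close> relative to the affine hull of its
  domain, and \<open>\<pi>\<close> is the value of the directional derivative at \<open>x\<close> in the direction \<open>x\<^sub>0 - x\<close>, which is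
  required to be finite.
\<close>

locale Gamma0_rel_cont = Gamma0_at f x a
  for f :: "'a::locally_convex_space \<Rightarrow> ereal" and x a +
  fixes x\<^sub>0 :: 'a and V :: "'a set" and M \<pi> :: real
  assumes V: "open V" "0 \<in> V"
    and x\<^sub>0: "x\<^sub>0 \<in> affine hull (eff_dom f)"
    and bound: "\<And>v. v \<in> V \<Longrightarrow> x\<^sub>0 + v \<in> affine hull (eff_dom f) \<Longrightarrow> f (x\<^sub>0 + v) \<le> ereal M"
    and \<pi>_lower: "\<And>r. (x\<^sub>0 - x, r) \<in> dir_epi f x \<Longrightarrow> \<pi> \<le> r"
    and \<pi>_approx: "\<And>\<eta>. \<eta> > 0 \<Longrightarrow> \<exists>r<\<pi> + \<eta>. (x\<^sub>0 - x, r) \<in> dir_epi f x"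
begin

definition L where "L = {w. x\<^sub>0 + w \<in> affine hull (eff_dom f)}"

lemma subspace_L: "subspace L"
proof -
  have comb: "u *\<^sub>R v + w *\<^sub>R v' \<in> L" if "v \<in> L" "v' \<in> L" for u w v v'
  proof -
    have "(1 - u - w) *\<^sub>R x\<^sub>0 + u *\<^sub>R (x\<^sub>0 + v) + w *\<^sub>R (x\<^sub>0 + v') \<in> affine hull (eff_dom f)"
      using that x\<^sub>0 by (intro mem_affine_3 affine_affine_hull) (auto simp: L_def)
    then show ?thesis by (simp add: L_def algebra_simps)
  qed
  show ?thesis
  proof (rule subspaceI)
    show "0 \<in> L" using x\<^sub>0 by (simp add: L_def)
    show "v + w \<in> L" if "v \<in> L" "w \<in> L" for v w using comb[OF that, of 1 1] by simp
    show "c *\<^sub>R v \<in> L" if "v \<in> L" for c v using comb[OF that that, of c 0] by simp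
  qed
qed

lemma direction_in_L: "x\<^sub>0 - x \<in> L"
proof -
  have "x \<in> affine hull (eff_dom f)" using fx by (intro hull_inc) (simp add: eff_dom_def)
  then have "x - x\<^sub>0 \<in> L" by (simp add: L_def)
  from subspace_neg[OF subspace_L this] show ?thesis by simp
qed

lemma dir_epi_in_L:
  assumes "(w, r) \<in> E" shows "w \<in> L"
proof -
  obtain s where s: "s > 0" "f (x + s *\<^sub>R w) \<le> ereal (a + s * r)" using assms dir_epi_iff by auto
  have "x + s *\<^sub>R w \<in> eff_dom f" using s(2) by (auto simp: eff_dom_def intro: le_less_trans)
  then have "x + s *\<^sub>R w - x\<^sub>0 \<in> L" by (simp add: L_def hull_inc)
  from subspace_add[OF subspace_L this direction_in_L] have "s *\<^sub>R w \<in> L" by (simp add: algebra_simps)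
  from subspace_scale[OF subspace_L this, of "1 / s"] show ?thesis using s(1) by simp
qed

text \<open>
  The complement of \<open>L\<close> is open because of lower semicontinuity: if \<open>h\<close> is outside \<open>L\<close>, then \<open>f = \<infinity>\<close> at
  \<open>x\<^sub>0 + s h\<close>, so \<open>f > M\<close> nearby, whereas \<open>f \<le> M\<close> on \<open>x\<^sub>0 + L\<close> close to \<open>x\<^sub>0\<close>. The factor \<open>s\<close> moves the
  point into the region where the bound \<open>M\<close> is valid.
\<close>

lemma L_closed:
  assumes "h \<notin> L"
  obtains U where "open U" "h \<in> U" "U \<inter> L = {}"
proof -
  obtain s where s: "s > 0" "s *\<^sub>R h \<in> V" using open_absorbing[OF V] by blast
  have "s *\<^sub>R h \<notin> L"
  proof
    assume "s *\<^sub>R h \<in> L"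
    from subspace_scale[OF subspace_L this, of "1 / s"] show False using s(1) assms by simp
  qed
  then have "x\<^sub>0 + s *\<^sub>R h \<notin> eff_dom f" using hull_subset[of "eff_dom f" affine] by (auto simp: L_def)
  then have "ereal M < f (x\<^sub>0 + s *\<^sub>R h)" by (simp add: eff_dom_def)
  from Gamma0_lscE[OF Gamma0_f this]
  obtain N where N: "open N" "x\<^sub>0 + s *\<^sub>R h \<in> N" "\<And>y. y \<in> N \<Longrightarrow> ereal M < f y" by blast
  define U where "U = {y. s *\<^sub>R y \<in> V} \<inter> {y. x\<^sub>0 + s *\<^sub>R y \<in> N}"
  have "open U"
    unfolding U_def
    by (intro open_Int open_Collect_mem V N continuous_on_scaleR_lcs continuous_on_const
        continuous_on_add continuous_on_id)
  moreover have "h \<in> U" using s N by (simp add: U_def)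
  moreover have "y \<notin> L" if "y \<in> U" for y
  proof
    assume "y \<in> L"
    then have "s *\<^sub>R y \<in> L" by (rule subspace_scale[OF subspace_L])
    then have "f (x\<^sub>0 + s *\<^sub>R y) \<le> ereal M" using that bound by (simp add: U_def L_def)
    moreover have "ereal M < f (x\<^sub>0 + s *\<^sub>R y)" using that N(3) by (simp add: U_def)
    ultimately show False by simp
  qed
  ultimately show ?thesis using that by blast
qed

lemma dir_epi_bound:
  assumes "v \<in> V" "v \<in> L" shows "(x\<^sub>0 - x + v, M - a) \<in> E"
proof -
  have "f (x + 1 *\<^sub>R (x\<^sub>0 - x + v)) \<le> ereal (a + 1 * (M - a))"
    using bound[OF assms(1)] assms(2) by (simp add: L_def)
  then show ?thesis unfolding dir_epi_iff by (intro exI[of _ 1]) simp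
qed

text \<open>
  Convexity turns the bound on a neighbourhood of \<open>x\<^sub>0 - x\<close> into upper semicontinuity of the directional
  derivative there, relative to \<open>L\<close>: shrink the neighbourhood by a factor \<open>\<mu>\<close> that makes the contribution of
  the bound at most \<open>\<eta>\<close>.
\<close>

lemma dir_epi_near_direction:
  assumes "\<eta> > 0"
  shows "\<exists>\<mu>>0. \<forall>v\<in>V. v \<in> L \<longrightarrow> (x\<^sub>0 - x + \<mu> *\<^sub>R v, \<pi> + \<eta>) \<in> E"
proof -
  obtain r where r: "r < \<pi> + \<eta>" "(x\<^sub>0 - x, r) \<in> E" using \<pi>_approx[OF assms] by blast
  define K where "K = max 1 (M - a - r)"
  define \<mu> where "\<mu> = min 1 ((\<pi> + \<eta> - r) / K)"
  have K: "K \<ge> 1" "M - a - r \<le> K" by (auto simp: K_def)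
  have "\<mu> \<le> (\<pi> + \<eta> - r) / K" by (simp add: \<mu>_def)
  then have \<mu>K: "\<mu> * K \<le> \<pi> + \<eta> - r" using K(1) by (simp add: pos_le_divide_eq)
  have \<mu>01: "\<mu> > 0" "\<mu> \<le> 1" using r(1) K(1) by (auto simp: \<mu>_def)
  note \<mu> = \<mu>01 \<mu>K
  have "(x\<^sub>0 - x + \<mu> *\<^sub>R v, \<pi> + \<eta>) \<in> E" if v: "v \<in> V" "v \<in> L" for v
  proof -
    have "(1 - \<mu>) *\<^sub>R (x\<^sub>0 - x, r) + \<mu> *\<^sub>R (x\<^sub>0 - x + v, M - a) \<in> E"
      using \<mu> by (intro convexD[OF convex_dir_epi] r(2) dir_epi_bound v) auto
    then have mem: "(x\<^sub>0 - x + \<mu> *\<^sub>R v, r + \<mu> * (M - a - r)) \<in> E" by (simp add: algebra_simps)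
    have "\<mu> * (M - a - r) \<le> \<mu> * K" using \<mu>(1) K(2) by (intro mult_left_mono) auto
    then have "r + \<mu> * (M - a - r) \<le> \<pi> + \<eta>" using \<mu>(3) by linarith
    with mem show ?thesis by (rule dir_epi_upward)
  qed
  with \<mu>(1) show ?thesis by (intro exI[of _ \<mu>] conjI ballI impI)
qed

text \<open>
  Let \<open>w\<close> be near \<open>h\<close>. If both lie in \<open>L\<close>, then \<open>h + \<delta> (x\<^sub>0 - x)\<close> is \<open>w\<close> plus \<open>\<delta>\<close> times a direction close to
  \<open>x\<^sub>0 - x\<close>, where the derivative is at most \<open>\<pi> + \<eta>/\<delta>\<close>; subadditivity bounds the derivative at \<open>w\<close> from
  below. If \<open>h\<close> is outside the closed subspace \<open>L\<close>, then the derivative is infinite near \<open>h\<close>.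
\<close>

lemma dir_epi_lower_semicontinuous:
  assumes h: "(h + \<delta> *\<^sub>R (x\<^sub>0 - x), c) \<notin> E" and \<delta>: "\<delta> > 0" and \<eta>: "\<eta> > 0"
  shows "\<exists>U. open U \<and> h \<in> U \<and> (\<forall>w\<in>U. \<forall>r. (w, r) \<in> E \<longrightarrow> c - \<delta> * \<pi> - \<eta> \<le> r)"
proof (cases "h \<in> L")
  case False
  then obtain U where "open U" "h \<in> U" "U \<inter> L = {}" by (rule L_closed)
  then show ?thesis using dir_epi_in_L by (intro exI[of _ U]) blast
next
  case True
  obtain \<mu> where \<mu>: "\<mu> > 0"
    and near: "\<forall>v\<in>V. v \<in> L \<longrightarrow> (x\<^sub>0 - x + \<mu> *\<^sub>R v, \<pi> + \<eta> / \<delta>) \<in> E"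
    using dir_epi_near_direction[OF divide_pos_pos[OF \<eta> \<delta>]] by blast
  define U where "U = {w. (1 / (\<delta> * \<mu>)) *\<^sub>R (h - w) \<in> V}"
  have "open U"
    unfolding U_def
    by (intro open_Collect_mem V continuous_on_scaleR_lcs continuous_on_const
        continuous_on_diff continuous_on_id)
  moreover have "h \<in> U" using V by (simp add: U_def)
  moreover have "c - \<delta> * \<pi> - \<eta> \<le> r" if w: "w \<in> U" and E: "(w, r) \<in> E" for w r
  proof (rule ccontr)
    assume less: "\<not> ?thesis"
    define v where "v = (1 / (\<delta> * \<mu>)) *\<^sub>R (h - w)"
    have "v \<in> V" using w by (simp add: U_def v_def)
    moreover have "v \<in> L"
      unfolding v_def by (intro subspace_scale[OF subspace_L] subspace_diff[OF subspace_L] True dir_epi_in_L[OF E])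
    ultimately have "(x\<^sub>0 - x + \<mu> *\<^sub>R v, \<pi> + \<eta> / \<delta>) \<in> E" using near by blast
    from dir_epi_scale[OF this \<delta>]
    have "(\<delta> *\<^sub>R (x\<^sub>0 - x + \<mu> *\<^sub>R v), \<delta> * (\<pi> + \<eta> / \<delta>)) \<in> E" .
    from dir_epi_add[OF E this]
    have "(w + \<delta> *\<^sub>R (x\<^sub>0 - x + \<mu> *\<^sub>R v), r + \<delta> * (\<pi> + \<eta> / \<delta>)) \<in> E" .
    moreover have "w + \<delta> *\<^sub>R (x\<^sub>0 - x + \<mu> *\<^sub>R v) = h + \<delta> *\<^sub>R (x\<^sub>0 - x)"
      using \<delta> \<mu> by (simp add: v_def scaleR_add_right)
    moreover have "r + \<delta> * (\<pi> + \<eta> / \<delta>) \<le> c" using less \<delta> by (simp add: algebra_simps)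
    ultimately have "(h + \<delta> *\<^sub>R (x\<^sub>0 - x), c) \<in> E"
      using dir_epi_upward[of "w + \<delta> *\<^sub>R (x\<^sub>0 - x + \<mu> *\<^sub>R v)" "r + \<delta> * (\<pi> + \<eta> / \<delta>)" c] by simp
    then show False using h by simp
  qed
  ultimately show ?thesis by (intro exI[of _ U] conjI ballI allI impI)
qed

text \<open>
  By the previous lemma, applied to the multiples of \<open>h\<close>, the segment from \<open>(0, - 1)\<close> to
  \<open>(S h, S (c - \<delta> \<pi>) - 1)\<close> can be separated from the cone \<open>dir_epi f x\<close>. A functional that is bounded below
  by \<open>- 1\<close> relative to a cone is nonnegative on it, so the separating functional is a subgradient; the end of
  the segment yields \<open>\<psi> h \<ge> c - \<delta> \<pi> - 1/S\<close>, and \<open>S = 1/\<eta>\<close>.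
\<close>

theorem subdiff_support:
  assumes h: "(h + \<delta> *\<^sub>R (x\<^sub>0 - x), c) \<notin> E" and \<delta>: "\<delta> > 0" and \<eta>: "\<eta> > 0"
  obtains \<psi> where "\<psi> \<in> subdiff f x" and "c - \<delta> * \<pi> - \<eta> \<le> \<psi> h"
proof -
  define c' where "c' = c - \<delta> * \<pi>"
  have above: "\<exists>U m. open U \<and> 0 + s *\<^sub>R h \<in> U \<and> - 1 + s * c' < m \<and> (\<forall>y\<in>U. \<forall>r. (y, r) \<in> E \<longrightarrow> m \<le> r)"
    if s: "s \<in> {0..1 / \<eta>}" for s
  proof -
    have "\<exists>U. open U \<and> s *\<^sub>R h \<in> U \<and> (\<forall>y\<in>U. \<forall>r. (y, r) \<in> E \<longrightarrow> s * c' - 1 / 2 \<le> r)"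
    proof (cases "s = 0")
      case True
      \<comment> \<open>At the foot of the segment the derivative must stay above \<open>- 1/2\<close> near the origin: the case \<open>h = 0\<close>, \<open>\<delta> = 1\<close>.\<close>
      have "(0 + 1 *\<^sub>R (x\<^sub>0 - x), \<pi> - 1 / 4) \<notin> E" using \<pi>_lower[of "\<pi> - 1 / 4"] by auto
      from dir_epi_lower_semicontinuous[OF this, of "1 / 4"] True show ?thesis by simp
    next
      case False
      have "(s *\<^sub>R h + (s * \<delta>) *\<^sub>R (x\<^sub>0 - x), s * c) \<notin> E"
      proof
        assume "(s *\<^sub>R h + (s * \<delta>) *\<^sub>R (x\<^sub>0 - x), s * c) \<in> E"
        from dir_epi_scale[OF this, of "1 / s"] show False
          using False s h by (simp add: scaleR_add_right)
      qed
      moreover have "s * c - s * \<delta> * \<pi> - 1 / 2 = s * c' - 1 / 2" by (simp add: c'_def algebra_simps)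
      ultimately show ?thesis
        using dir_epi_lower_semicontinuous[of "s *\<^sub>R h" "s * \<delta>" "s * c" "1 / 2"] False s \<delta> by simp
    qed
    then obtain U where U: "open U" "s *\<^sub>R h \<in> U" "\<forall>y\<in>U. \<forall>r. (y, r) \<in> E \<longrightarrow> s * c' - 1 / 2 \<le> r"
      by blast
    then show ?thesis by (intro exI[of _ U] exI[of _ "s * c' - 1 / 2"]) simp
  qed
  have origin: "(0, 0) \<in> E" by (simp add: dir_epi_zero)
  have S: "1 / \<eta> \<ge> 0" using \<eta> by simp
  obtain \<psi> where dual: "\<psi> \<in> topological_dual" and
    \<psi>: "\<And>y r s. (y, r) \<in> E \<Longrightarrow> s \<in> {0..1 / \<eta>} \<Longrightarrow> - 1 + s * c' + \<psi> y \<le> r + \<psi> 0 + s * \<psi> h"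
    using separate_segment_below_convex[OF convex_dir_epi origin S above] by blast
  interpret linear \<psi> by (rule dual_linear[OF dual])
  have E_le: "\<psi> w \<le> r" if "(w, r) \<in> E" for w r
  proof (rule ccontr)
    assume less: "\<not> \<psi> w \<le> r"
    \<comment> \<open>Scaling a violated inequality by this \<open>t\<close> would produce the value \<open>- 2\<close>, below the bound \<open>- 1\<close>.\<close>
    define t where "t = 2 / (\<psi> w - r)"
    have t: "t > 0" using less by (simp add: t_def)
    have "- 1 + t * \<psi> w \<le> t * r" using \<psi>[OF dir_epi_scale[OF that t], of 0] \<eta> by (simp add: scale)
    moreover have "\<psi> w - r \<noteq> 0" using less by simp
    then have "t * (\<psi> w - r) = 2" unfolding t_def by (simp only: times_divide_eq_left nonzero_mult_div_cancel_right not_False_eq_True)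
    ultimately show False by (simp add: algebra_simps)
  qed
  have "\<psi> (y - x) \<le> r - a + 0" if "f y \<le> ereal r" for y r
  proof -
    have "(y - x, r - a) \<in> E" unfolding dir_epi_iff using that by (intro exI[of _ 1]) simp
    then show ?thesis using E_le by simp
  qed
  then have "\<psi> \<in> subdiff f x" using dual eps_subdiff_finite_iff by blast
  moreover have "1 / \<eta> * (c' - \<psi> h) \<le> 1"
    using \<psi>[OF origin, of "1 / \<eta>"] \<eta> by (simp add: algebra_simps)
  then have "c - \<delta> * \<pi> - \<eta> \<le> \<psi> h" using \<eta> by (simp add: c'_def field_simps)
  ultimately show ?thesis using that by blast
qed

end

section \<open>Calculus of approximate subdifferentials\<close>

lemma dual_add: "\<phi> \<in> topological_dual \<Longrightarrow> \<psi> \<in> topological_dual \<Longrightarrow> \<phi> + \<psi> \<in> topological_dual"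
  and dual_diff: "\<phi> \<in> topological_dual \<Longrightarrow> \<psi> \<in> topological_dual \<Longrightarrow> \<phi> - \<psi> \<in> topological_dual"
  and dual_scale: "\<phi> \<in> topological_dual \<Longrightarrow> c *\<^sub>R \<phi> \<in> topological_dual"
  and dual_zero: "0 \<in> topological_dual"
proof -
  show "\<phi> + \<psi> \<in> topological_dual" if "\<phi> \<in> topological_dual" "\<psi> \<in> topological_dual"
    using that linear_compose_add[of \<phi> \<psi>]
    by (auto simp: topological_dual_def plus_fun_def intro: continuous_intros)
  show "\<phi> - \<psi> \<in> topological_dual" if "\<phi> \<in> topological_dual" "\<psi> \<in> topological_dual"
    using that linear_compose_sub[of \<phi> \<psi>]
    by (auto simp: topological_dual_def fun_diff_def intro: continuous_intros)
  show "c *\<^sub>R \<phi> \<in> topological_dual" if "\<phi> \<in> topological_dual"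
    using that linear_compose_scale_right[of \<phi> c]
    by (auto simp: topological_dual_def scaleR_fun_def intro: continuous_intros)
  show "0 \<in> topological_dual"
    using module_hom_zero by (simp add: topological_dual_def zero_fun_def linear_iff)
qed

lemma eps_subdiff_dual: "\<psi> \<in> eps_subdiff \<epsilon> f x \<Longrightarrow> \<psi> \<in> topological_dual"
  by (simp add: eps_subdiff_def split: if_splits)

lemma eps_subdiff_at_finite:
  assumes "\<psi> \<in> eps_subdiff \<epsilon> f x"
  obtains a where "f x = ereal a"
  using assms by (cases "f x") (auto simp: eps_subdiff_def)

lemma convex_eps_subdiff: "convex (eps_subdiff \<epsilon> f x)"
proof (rule convexI)
  fix \<phi> \<psi> :: "'a \<Rightarrow> real" and u v :: real
  assume \<phi>: "\<phi> \<in> eps_subdiff \<epsilon> f x" and \<psi>: "\<psi> \<in> eps_subdiff \<epsilon> f x"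
    and uv: "0 \<le> u" "0 \<le> v" "u + v = 1"
  obtain a where a: "f x = ereal a" using \<phi> by (rule eps_subdiff_at_finite)
  note iff = eps_subdiff_finite[where f = f and x = x, OF a]
  have "u * \<phi> (y - x) + v * \<psi> (y - x) \<le> r - a + \<epsilon>" if "f y \<le> ereal r" for y r
  proof -
    have "\<phi> (y - x) \<le> r - a + \<epsilon>" "\<psi> (y - x) \<le> r - a + \<epsilon>" using \<phi> \<psi> that iff by blast+
    then show ?thesis using uv by (intro convex_bound_le)
  qed
  then show "u *\<^sub>R \<phi> + v *\<^sub>R \<psi> \<in> eps_subdiff \<epsilon> f x"
    using \<phi> \<psi> unfolding iff by (simp add: dual_add dual_scale)
qed

lemma eps_subdiff_add:
  assumes \<phi>: "\<phi> \<in> eps_subdiff \<epsilon> f x" and \<psi>: "\<psi> \<in> eps_subdiff \<delta> g x"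
    and f: "\<And>y. f y > - \<infinity>" and g: "\<And>y. g y > - \<infinity>"
  shows "\<phi> + \<psi> \<in> eps_subdiff (\<epsilon> + \<delta>) (\<lambda>y. f y + g y) x"
proof -
  obtain a where a: "f x = ereal a" using \<phi> by (rule eps_subdiff_at_finite)
  obtain b where b: "g x = ereal b" using \<psi> by (rule eps_subdiff_at_finite)
  have ab: "f x + g x = ereal (a + b)" using a b by simp
  have "(\<phi> + \<psi>) (y - x) \<le> r - (a + b) + (\<epsilon> + \<delta>)" if r: "f y + g y \<le> ereal r" for y r
  proof -
    obtain p where p: "f y = ereal p" using r f[of y] g[of y] by (cases "f y"; cases "g y") auto
    obtain q where q: "g y = ereal q" using r f[of y] g[of y] by (cases "f y"; cases "g y") auto
    have "\<phi> (y - x) \<le> p - a + \<epsilon>"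
      using \<phi> p eps_subdiff_finite[where f = f and x = x, OF a] by simp
    moreover have "\<psi> (y - x) \<le> q - b + \<delta>"
      using \<psi> q eps_subdiff_finite[where f = g and x = x, OF b] by simp
    ultimately show ?thesis using r p q by simp
  qed
  then show ?thesis
    using eps_subdiff_finite[where f = "\<lambda>y. f y + g y" and x = x, OF ab]
      dual_add[OF eps_subdiff_dual[OF \<phi>] eps_subdiff_dual[OF \<psi>]] by blast
qed

lemma zero_subdiff_zero: "0 \<in> subdiff (\<lambda>y. 0) x"
  by (simp add: eps_subdiff_def dual_zero)

lemma eps_subdiff_sum:
  assumes "finite I" and "\<And>t. t \<in> I \<Longrightarrow> \<psi> t \<in> eps_subdiff (\<epsilon> t) (f t) x"
    and "\<And>t y. t \<in> I \<Longrightarrow> f t y > - \<infinity>"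
  shows "(\<Sum>t\<in>I. \<psi> t) \<in> eps_subdiff (\<Sum>t\<in>I. \<epsilon> t) (\<lambda>y. \<Sum>t\<in>I. f t y) x"
  using assms
proof (induction I rule: finite_induct)
  case empty
  show ?case unfolding sum.empty by (rule zero_subdiff_zero)
next
  case (insert t I)
  have "\<psi> t + (\<Sum>t\<in>I. \<psi> t) \<in> eps_subdiff (\<epsilon> t + (\<Sum>t\<in>I. \<epsilon> t)) (\<lambda>y. f t y + (\<Sum>t\<in>I. f t y)) x"
    using insert by (intro eps_subdiff_add sum_ereal_gt_MInf) auto
  then show ?case unfolding sum.insert[OF insert.hyps] .
qed

text \<open>
  The inclusion of the right-hand sides in the subdifferential: the inequalities defining
  \<open>\<partial>\<^sub>c\<^sub>\<epsilon>F(x)\<close> pass to the weak* closure, and then \<open>\<epsilon>\<close> tends to \<open>0\<close>. That \<open>F x\<close> is finite follows from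
  \<open>A 1\<close> being nonempty.
\<close>

lemma subdiff_of_closures:
  assumes \<phi>: "\<And>\<epsilon>. \<epsilon> > 0 \<Longrightarrow> \<phi> \<in> weak_star_topology closure_of (A \<epsilon>)"
    and A: "\<And>\<epsilon> \<psi>. \<epsilon> > 0 \<Longrightarrow> \<psi> \<in> A \<epsilon> \<Longrightarrow> \<psi> \<in> eps_subdiff (c * \<epsilon>) F x" and c: "c \<ge> 0"
  shows "\<phi> \<in> subdiff F x"
proof -
  have dual: "\<phi> \<in> topological_dual"
    using \<phi>[of 1] closure_of_subset_topspace[of weak_star_topology "A 1"] by auto
  have "A 1 \<noteq> {}" using \<phi>[of 1] by auto
  then obtain \<psi> where "\<psi> \<in> eps_subdiff (c * 1) F x" using A[of 1] by force
  then obtain a where a: "F x = ereal a" by (rule eps_subdiff_at_finite)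
  note iff = eps_subdiff_finite[where f = F and x = x, OF a]
  have "\<phi> (y - x) \<le> r - a + 0" if r: "F y \<le> ereal r" for y r
  proof -
    have le: "\<phi> (y - x) \<le> r - a + c * \<epsilon>" if \<epsilon>: "\<epsilon> > 0" for \<epsilon>
      by (rule weak_star_closure_le[OF \<phi>[OF \<epsilon>]]) (use A[OF \<epsilon>] r iff in blast)
    show ?thesis
    proof (rule field_le_epsilon)
      fix e :: real assume e: "e > 0"
      have "c * (e / (c + 1)) \<le> e" using c e by (simp add: field_simps)
      then show "\<phi> (y - x) \<le> r - a + 0 + e" using le[of "e / (c + 1)"] c e by simp
    qed
  qed
  then show ?thesis using dual iff by blast
qed

text \<open>
  The Moreau-Rockafellar sum rule. A splitting \<open>\<phi> = \<psi> + (\<phi> - \<psi>)\<close> into subgradients of \<open>f\<close> and \<open>G\<close> amounts to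
  \<open>\<psi> (y - z) \<le> (f y - f x) + (G z - G x) - \<phi> (z - x)\<close> for all \<open>y\<close> and \<open>z\<close>. These demands are consistent at
  \<open>y = z\<close> because \<open>\<phi>\<close> is a subgradient of the sum, and with \<open>z = x\<^sub>0\<close> and \<open>y\<close> near \<open>x\<^sub>0\<close> they bound \<open>\<psi>\<close> on a
  neighbourhood of the origin.
\<close>

theorem subdiff_add_split:
  fixes f G :: "'a::locally_convex_space \<Rightarrow> ereal"
  assumes f: "convex_fun f" and G: "convex_fun G"
    and a: "f x = ereal a" and b: "G x = ereal b"
    and V: "open V" "0 \<in> V" and bound: "\<And>v. v \<in> V \<Longrightarrow> f (x\<^sub>0 + v) \<le> ereal M"
    and N: "G x\<^sub>0 \<le> ereal N"
    and \<phi>: "\<phi> \<in> subdiff (\<lambda>y. f y + G y) x"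
  obtains \<psi> where "\<psi> \<in> subdiff f x" and "\<phi> - \<psi> \<in> subdiff G x"
proof -
  have ab: "f x + G x = ereal (a + b)" using a b by simp
  have lin\<phi>: "linear \<phi>" and \<phi>_le: "\<And>y r. f y + G y \<le> ereal r \<Longrightarrow> \<phi> (y - x) \<le> r - (a + b) + 0"
    using \<phi> eps_subdiff_finite[where f = "\<lambda>y. f y + G y" and x = x, OF ab] dual_linear by blast+
  interpret \<phi>: linear \<phi> by (rule lin\<phi>)
  define C where "C = {(y - z, p + q - (a + b) - \<phi> (z - x)) | y z p q. (y, p) \<in> epi f \<and> (z, q) \<in> epi G}"
  have memC: "(y - z, p + q - (a + b) - \<phi> (z - x)) \<in> C" if "f y \<le> ereal p" "G z \<le> ereal q" for y z p q
    using that unfolding C_def epi_def by blast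
  have conv: "convex C"
  proof (rule convexI)
    fix c d and u v :: real assume cd: "c \<in> C" "d \<in> C" and uv: "0 \<le> u" "0 \<le> v" "u + v = 1"
    obtain y z p q where c: "c = (y - z, p + q - (a + b) - \<phi> (z - x))" "(y, p) \<in> epi f" "(z, q) \<in> epi G"
      using cd(1) unfolding C_def by blast
    obtain y' z' p' q' where d: "d = (y' - z', p' + q' - (a + b) - \<phi> (z' - x))" "(y', p') \<in> epi f" "(z', q') \<in> epi G"
      using cd(2) unfolding C_def by blast
    have "u *\<^sub>R (y, p) + v *\<^sub>R (y', p') \<in> epi f" by (rule convexD[OF convex_epi[OF f] c(2) d(2) uv])
    moreover have "u *\<^sub>R (z, q) + v *\<^sub>R (z', q') \<in> epi G" by (rule convexD[OF convex_epi[OF G] c(3) d(3) uv])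
    ultimately have "((u *\<^sub>R y + v *\<^sub>R y') - (u *\<^sub>R z + v *\<^sub>R z'),
        (u * p + v * p') + (u * q + v * q') - (a + b) - \<phi> ((u *\<^sub>R z + v *\<^sub>R z') - x)) \<in> C"
      by (intro memC) (auto simp: epi_def)
    also have "((u *\<^sub>R y + v *\<^sub>R y') - (u *\<^sub>R z + v *\<^sub>R z'),
        (u * p + v * p') + (u * q + v * q') - (a + b) - \<phi> ((u *\<^sub>R z + v *\<^sub>R z') - x)) =
      ((u *\<^sub>R y + v *\<^sub>R y') - (u *\<^sub>R z + v *\<^sub>R z'),
        (u * p + v * p') + (u * q + v * q') - (u + v) * (a + b) - \<phi> ((u *\<^sub>R z + v *\<^sub>R z') - (u + v) *\<^sub>R x))"
      using uv by simp
    also have "\<dots> = u *\<^sub>R c + v *\<^sub>R d"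
      unfolding c(1) d(1) by (simp add: \<phi>.diff \<phi>.add \<phi>.scale algebra_simps)
    finally show "u *\<^sub>R c + v *\<^sub>R d \<in> C" .
  qed
  have above: "r \<ge> 0" if r: "(0, r) \<in> C" for r
  proof -
    obtain y z p q where *: "(0, r) = (y - z, p + q - (a + b) - \<phi> (z - x))" "(y, p) \<in> epi f" "(z, q) \<in> epi G"
      using r unfolding C_def by blast
    then have "f z + G z \<le> ereal p + ereal q" by (intro add_mono) (auto simp: epi_def)
    then show ?thesis using \<phi>_le[of z "p + q"] * by simp
  qed
  have VC: "(v, M + N - (a + b) - \<phi> (x\<^sub>0 - x)) \<in> C" if "v \<in> V" for v
    using memC[OF bound[OF that] N] by simp
  obtain \<psi> where dual: "\<psi> \<in> topological_dual" and \<psi>: "\<And>w r. (w, r) \<in> C \<Longrightarrow> \<psi> w \<le> r"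
    using continuous_linear_minorant[OF conv above V VC] by blast
  interpret \<psi>: linear \<psi> by (rule dual_linear[OF dual])
  have "\<psi> (y - x) \<le> p - a + 0" if "f y \<le> ereal p" for y p
    using \<psi>[OF memC[OF that, of x b]] b by (simp add: \<phi>.zero)
  then have "\<psi> \<in> subdiff f x" using dual eps_subdiff_finite[where f = f and x = x, OF a] by blast
  moreover have "(\<phi> - \<psi>) (z - x) \<le> q - b + 0" if "G z \<le> ereal q" for z q
    using \<psi>[OF memC[of x a, OF _ that]] a by (simp add: \<phi>.diff \<psi>.diff)
  then have "\<phi> - \<psi> \<in> subdiff G x"
    using dual_diff[OF eps_subdiff_dual[OF \<phi>] dual]
      eps_subdiff_finite[where f = G and x = x, OF b] by blast
  ultimately show ?thesis using that by blast
qed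

lemma subdiff_sum_split:
  fixes f :: "'i \<Rightarrow> 'a::locally_convex_space \<Rightarrow> ereal" and G :: "'a \<Rightarrow> ereal"
  assumes "finite I" and "\<And>t. t \<in> I \<Longrightarrow> convex_fun (f t)" and "\<And>t y. t \<in> I \<Longrightarrow> f t y > - \<infinity>"
    and "\<And>t. t \<in> I \<Longrightarrow> \<exists>V M. open V \<and> 0 \<in> V \<and> (\<forall>v\<in>V. f t (x\<^sub>0 + v) \<le> ereal M)"
    and G: "convex_fun G" "\<And>y. G y > - \<infinity>" "G x\<^sub>0 < \<infinity>"
    and "\<phi> \<in> subdiff (\<lambda>y. (\<Sum>t\<in>I. f t y) + G y) x"
  shows "\<phi> \<in> (\<Sum>t\<in>I. subdiff (f t) x) + subdiff G x"
  using assms(1-4,8)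
proof (induction I arbitrary: \<phi> rule: finite_induct)
  case empty
  then show ?case by simp
next
  case (insert t I)
  define H where "H y = (\<Sum>t\<in>I. f t y) + G y" for y
  have eq: "(\<lambda>y. (\<Sum>t\<in>insert t I. f t y) + G y) = (\<lambda>y. f t y + H y)"
    using insert.hyps by (simp add: H_def add.assoc)
  have sumI: "(\<Sum>t\<in>I. f t y) > - \<infinity>" for y using insert.prems(2) by (intro sum_ereal_gt_MInf) auto
  have H_gt: "H y > - \<infinity>" for y using sumI[of y] G(2)[of y] by (simp add: H_def)
  have H: "convex_fun H"
    unfolding H_def by (intro convex_fun_add convex_fun_sum G(1,2) sumI) (use insert.prems in auto)
  have \<phi>: "\<phi> \<in> subdiff (\<lambda>y. f t y + H y) x" using insert.prems(4) unfolding eq .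
  then obtain c where c: "f t x + H x = ereal c" by (rule eps_subdiff_at_finite)
  obtain a where a: "f t x = ereal a"
    using c insert.prems(2)[of t x] H_gt[of x] by (cases "f t x"; cases "H x") auto
  obtain b where b: "H x = ereal b"
    using c insert.prems(2)[of t x] H_gt[of x] by (cases "f t x"; cases "H x") auto
  have fin: "f s x\<^sub>0 < \<infinity>" if s: "s \<in> insert t I" for s
  proof -
    obtain V M where "0 \<in> V" "\<forall>v\<in>V. f s (x\<^sub>0 + v) \<le> ereal M" using insert.prems(3)[OF s] by blast
    then have "f s x\<^sub>0 \<le> ereal M" by force
    then show ?thesis by (rule le_less_trans) simp
  qed
  have "(\<Sum>t\<in>I. f t x\<^sub>0) \<noteq> \<infinity>" using fin by (auto simp: sum_Pinfty)
  then have "H x\<^sub>0 \<noteq> \<infinity>" using G(3) by (simp add: H_def)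
  then obtain N where N: "H x\<^sub>0 \<le> ereal N" using H_gt[of x\<^sub>0] by (cases "H x\<^sub>0") auto
  obtain V M where V: "open V" "0 \<in> V" "\<forall>v\<in>V. f t (x\<^sub>0 + v) \<le> ereal M"
    using insert.prems(3)[of t] by blast
  obtain \<psi> where \<psi>: "\<psi> \<in> subdiff (f t) x" "\<phi> - \<psi> \<in> subdiff H x"
    by (rule subdiff_add_split[of "f t" H x a b V x\<^sub>0 M N \<phi>]) (use insert.prems(1) H a b V N \<phi> in auto)
  have "\<phi> - \<psi> \<in> (\<Sum>t\<in>I. subdiff (f t) x) + subdiff G x"
    using insert.prems by (intro insert.IH \<psi>(2)[unfolded H_def]) blast+
  then have "\<psi> + (\<phi> - \<psi>) \<in> subdiff (f t) x + ((\<Sum>t\<in>I. subdiff (f t) x) + subdiff G x)"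
    using \<psi>(1) by (intro set_plus_intro)
  moreover have "\<psi> + (\<phi> - \<psi>) = \<phi>" by simp
  ultimately show ?case unfolding sum.insert[OF insert.hyps] add.assoc by simp
qed

section \<open>The sum rules\<close>

lemma sum_fun_eval: "(\<Sum>t\<in>I. \<psi> t) y = (\<Sum>t\<in>I. \<psi> t y)" for \<psi> :: "'i \<Rightarrow> 'a \<Rightarrow> real"
  by (induction I rule: infinite_finite_induct) auto

text \<open>
  A subgradient of the sum is dominated by the sum of the directional derivatives, since a sufficiently
  small common step realises all the bounds \<open>r t\<close>.
\<close>

lemma dir_epi_common:
  fixes f :: "'i \<Rightarrow> 'a::locally_convex_space \<Rightarrow> ereal"
  assumes T: "finite T" and conv: "\<And>t. t \<in> T \<Longrightarrow> convex_fun (f t)"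
    and a: "\<And>t. t \<in> T \<Longrightarrow> f t x = ereal (a t)"
    and \<phi>: "\<phi> \<in> subdiff (\<lambda>y. \<Sum>t\<in>T. f t y) x"
    and r: "\<And>t. t \<in> T \<Longrightarrow> (k, r t) \<in> dir_epi (f t) x"
  shows "\<phi> k \<le> (\<Sum>t\<in>T. r t)"
proof -
  have "\<exists>s>0. f t (x + s *\<^sub>R k) \<le> ereal (a t + s * r t)" if "t \<in> T" for t
    using r[OF that] a[OF that] by (simp add: dir_epi_def)
  then obtain s where s: "\<And>t. t \<in> T \<Longrightarrow> s t > 0 \<and> f t (x + s t *\<^sub>R k) \<le> ereal (a t + s t * r t)"
    by metis
  define m where "m = Min (insert 1 (s ` T))"
  have m: "m > 0" "\<And>t. t \<in> T \<Longrightarrow> m \<le> s t" using T s by (auto simp: m_def)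
  have le: "f t (x + m *\<^sub>R k) \<le> ereal (a t + m * r t)" if t: "t \<in> T" for t
  proof -
    interpret convex_at "f t" x "a t" by unfold_locales (use conv a t in auto)
    show ?thesis by (rule convex_fun_quotient_mono) (use s[OF t] m t in auto)
  qed
  have "(\<Sum>t\<in>T. f t (x + m *\<^sub>R k)) \<le> (\<Sum>t\<in>T. ereal (a t + m * r t))" by (rule sum_mono[OF le])
  then have le: "(\<Sum>t\<in>T. f t (x + m *\<^sub>R k)) \<le> ereal (\<Sum>t\<in>T. a t + m * r t)" by simp
  have A: "(\<Sum>t\<in>T. f t x) = ereal (\<Sum>t\<in>T. a t)" using a by simp
  note iff = eps_subdiff_finite[where f = "\<lambda>y. \<Sum>t\<in>T. f t y" and x = x, OF A]
  have "\<phi> (x + m *\<^sub>R k - x) \<le> (\<Sum>t\<in>T. a t + m * r t) - (\<Sum>t\<in>T. a t) + 0" using \<phi> le iff by blast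
  then have "m * \<phi> k \<le> m * (\<Sum>t\<in>T. r t)"
    using linear_scale[OF dual_linear[OF eps_subdiff_dual[OF \<phi>]], of m k]
    by (simp add: sum.distrib sum_distrib_left)
  then show ?thesis using m(1) by simp
qed

text \<open>
  Upper bounds for all derivatives in the direction \<open>u\<close> yield a lower bound for each of them: this is what
  excludes the value \<open>- \<infinity>\<close> in the direction of \<open>x\<^sub>0\<close>.
\<close>

lemma dir_epi_lower_bound:
  fixes f :: "'i \<Rightarrow> 'a::locally_convex_space \<Rightarrow> ereal"
  assumes T: "finite T" and conv: "\<And>t. t \<in> T \<Longrightarrow> convex_fun (f t)"
    and a: "\<And>t. t \<in> T \<Longrightarrow> f t x = ereal (a t)"
    and \<phi>: "\<phi> \<in> subdiff (\<lambda>y. \<Sum>t\<in>T. f t y) x"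
    and b: "\<And>t. t \<in> T \<Longrightarrow> (u, b t) \<in> dir_epi (f t) x"
    and t: "t \<in> T" and r: "(u, r) \<in> dir_epi (f t) x"
  shows "\<phi> u - (\<Sum>s\<in>T - {t}. b s) \<le> r"
proof -
  have "\<phi> u \<le> (\<Sum>s\<in>T. (b(t := r)) s)"
    by (rule dir_epi_common[OF T conv a \<phi>]) (use b r in auto)
  also have "\<dots> = r + (\<Sum>s\<in>T - {t}. b s)"
  proof -
    have "(\<Sum>s\<in>T - {t}. (b(t := r)) s) = (\<Sum>s\<in>T - {t}. b s)" by (rule sum.cong) auto
    then show ?thesis using sum.remove[OF T t, of "b(t := r)"] by simp
  qed
  finally show ?thesis by simp
qed

text \<open>
  The summands of a member of \<open>\<Sum>A t\<close> can be chosen independently of each other, so an upper bound for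
  the sum also bounds the sum of the suprema.
\<close>

lemma member_sum_le_imp_bdd:
  fixes A :: "'i \<Rightarrow> ('a \<Rightarrow> real) set"
  assumes T: "finite T" and ne: "\<And>t. t \<in> T \<Longrightarrow> A t \<noteq> {}"
    and le: "\<And>\<psi>. \<psi> \<in> (\<Sum>t\<in>T. A t) \<Longrightarrow> \<psi> h \<le> c"
  shows "\<And>t. t \<in> T \<Longrightarrow> bdd_above ((\<lambda>\<psi>. \<psi> h) ` A t)"
    and "(\<Sum>t\<in>T. SUP \<psi>\<in>A t. \<psi> h) \<le> c"
proof -
  have sum_le: "(\<Sum>t\<in>T. \<psi> t h) \<le> c" if "\<And>t. t \<in> T \<Longrightarrow> \<psi> t \<in> A t" for \<psi>
  proof -
    have "(\<Sum>t\<in>T. \<psi> t) \<in> (\<Sum>t\<in>T. A t)" using that unfolding set_sum_alt[OF T] by blast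
    then show ?thesis using le by (simp flip: sum_fun_eval)
  qed
  have "\<forall>t\<in>T. \<exists>g. g \<in> A t" using ne by blast
  from bchoice[OF this] obtain \<psi>\<^sub>0 where \<psi>\<^sub>0: "\<And>t. t \<in> T \<Longrightarrow> \<psi>\<^sub>0 t \<in> A t" by blast
  show bdd: "bdd_above ((\<lambda>\<psi>. \<psi> h) ` A t)" if t: "t \<in> T" for t
  proof (rule bdd_aboveI2)
    fix \<psi> assume \<psi>: "\<psi> \<in> A t"
    have "(\<Sum>s\<in>T. (\<psi>\<^sub>0(t := \<psi>)) s h) \<le> c" by (rule sum_le) (use \<psi> \<psi>\<^sub>0 in auto)
    moreover have "(\<Sum>s\<in>T - {t}. (\<psi>\<^sub>0(t := \<psi>)) s h) = (\<Sum>s\<in>T - {t}. \<psi>\<^sub>0 s h)"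
      by (rule sum.cong) auto
    ultimately show "\<psi> h \<le> c - (\<Sum>s\<in>T - {t}. \<psi>\<^sub>0 s h)"
      using sum.remove[OF T t, of "\<lambda>s. (\<psi>\<^sub>0(t := \<psi>)) s h"] by simp
  qed
  define n where "n = real (card T)"
  show "(\<Sum>t\<in>T. SUP \<psi>\<in>A t. \<psi> h) \<le> c"
  proof (rule field_le_epsilon)
    fix e :: real assume e: "e > 0"
    define d where "d = e / (n + 1)"
    have d: "d > 0" "n * d \<le> e" using e by (auto simp: d_def n_def field_simps)
    have "\<exists>\<psi>\<in>A t. (SUP \<psi>\<in>A t. \<psi> h) - d < \<psi> h" if t: "t \<in> T" for t
      using less_cSUP_iff[OF ne[OF t] bdd[OF t], of "(SUP \<psi>\<in>A t. \<psi> h) - d"] d(1) by simp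
    then obtain \<psi> where \<psi>: "\<And>t. t \<in> T \<Longrightarrow> \<psi> t \<in> A t \<and> (SUP \<psi>\<in>A t. \<psi> h) - d < \<psi> t h" by metis
    have "(\<Sum>t\<in>T. (SUP \<psi>\<in>A t. \<psi> h) - d) \<le> (\<Sum>t\<in>T. \<psi> t h)"
      using \<psi> by (intro sum_mono less_imp_le) blast
    also have "\<dots> \<le> c" using \<psi> by (intro sum_le) blast
    finally show "(\<Sum>t\<in>T. SUP \<psi>\<in>A t. \<psi> h) \<le> c + e" using d(2) by (simp add: sum_subtractf n_def)
  qed
qed

text \<open>
  The substantial inclusion of (i). For every index the fact \<open>support\<close> compares the directional derivative at
  \<open>h + \<delta> u\<close> with the support function of \<open>A t\<close> at \<open>h\<close>. It also gives that \<open>A t\<close> is nonempty, which the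
  separation argument presupposes.
\<close>

theorem subdiff_sum_subset_closure:
  fixes f :: "'i \<Rightarrow> 'a::locally_convex_space \<Rightarrow> ereal"
  assumes T: "finite T" and f: "\<And>t. t \<in> T \<Longrightarrow> f t \<in> Gamma0" and T\<^sub>0: "T\<^sub>0 \<subseteq> T"
    and dom: "\<And>t. t \<in> T \<Longrightarrow> x\<^sub>0 \<in> eff_dom (f t)"
    and cont: "\<And>t. t \<in> T\<^sub>0 \<Longrightarrow> \<exists>V M. open V \<and> 0 \<in> V \<and>
      (\<forall>v\<in>V. x\<^sub>0 + v \<in> affine hull (eff_dom (f t)) \<longrightarrow> f t (x\<^sub>0 + v) \<le> ereal M)"
    and \<phi>: "\<phi> \<in> subdiff (\<lambda>y. \<Sum>t\<in>T. f t y) x" and \<epsilon>: "\<epsilon> > 0"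
  shows "\<phi> \<in> weak_star_topology closure_of
    (\<Sum>t\<in>T. if t \<in> T\<^sub>0 then subdiff (f t) x else eps_subdiff \<epsilon> (f t) x)"
proof -
  define A where "A t = (if t \<in> T\<^sub>0 then subdiff (f t) x else eps_subdiff \<epsilon> (f t) x)" for t
  define u where "u = x\<^sub>0 - x"
  have conv: "convex_fun (f t)" if "t \<in> T" for t using f[OF that] by (rule Gamma0_convex)
  obtain F where F: "(\<Sum>t\<in>T. f t x) = ereal F" using \<phi> by (rule eps_subdiff_at_finite)
  have "\<bar>f t x\<bar> \<noteq> \<infinity>" if "t \<in> T" for t
    using F T that sum_Inf[of "\<lambda>t. f t x" T] by auto
  then have "\<exists>a. f t x = ereal a" if "t \<in> T" for t using that by (metis ereal_real)
  then obtain a where a: "\<And>t. t \<in> T \<Longrightarrow> f t x = ereal (a t)" by metis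
  have at: "Gamma0_at (f t) x (a t)" if "t \<in> T" for t
    by unfold_locales (use conv f a that in auto)
  have "\<exists>N. f t x\<^sub>0 = ereal N" if "t \<in> T" for t
    using dom[OF that] Gamma0_gt_MInf[OF f[OF that], of x\<^sub>0]
    by (cases "f t x\<^sub>0") (auto simp: eff_dom_def)
  then obtain N where N: "\<And>t. t \<in> T \<Longrightarrow> f t x\<^sub>0 = ereal (N t)" by metis
  define b where "b t = N t - a t" for t
  have b: "(u, b t) \<in> dir_epi (f t) x" if t: "t \<in> T" for t
    unfolding dir_epi_def using a[OF t] N[OF t] by (auto simp: u_def b_def intro!: exI[of _ 1])
  \<comment> \<open>Finiteness of the derivatives in the direction \<open>u\<close>.\<close>
  define low where "low t = \<phi> u - (\<Sum>s\<in>T - {t}. b s)" for t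
  have low: "low t \<le> r" if t: "t \<in> T" and r: "(u, r) \<in> dir_epi (f t) x" for t r
    unfolding low_def by (rule dir_epi_lower_bound[OF T conv a \<phi> b t r])
  have "\<exists>B. \<forall>h \<delta> c. \<delta> > 0 \<longrightarrow> (h + \<delta> *\<^sub>R u, c) \<notin> dir_epi (f t) x \<longrightarrow> (\<exists>\<psi>\<in>A t. c - \<delta> * B - \<delta> \<le> \<psi> h)"
    if t: "t \<in> T" for t
  proof (cases "t \<in> T\<^sub>0")
    case True
    define R where "R = {r. (u, r) \<in> dir_epi (f t) x}"
    have "bdd_below R" by (rule bdd_belowI[of _ "low t"]) (use low[OF t] in \<open>simp add: R_def\<close>)
    moreover have "R \<noteq> {}" using b[OF t] by (auto simp: R_def)
    ultimately have R: "R \<noteq> {}" "bdd_below R" by auto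
    obtain V M where V: "open V" "0 \<in> V"
      "\<forall>v\<in>V. x\<^sub>0 + v \<in> affine hull (eff_dom (f t)) \<longrightarrow> f t (x\<^sub>0 + v) \<le> ereal M"
      using cont[OF True] by blast
    interpret Gamma0_at "f t" x "a t" by (rule at[OF t])
    interpret Gamma0_rel_cont "f t" x "a t" x\<^sub>0 V M "Inf R"
    proof unfold_locales
      show "open V" "0 \<in> V" by (rule V)+
      show "x\<^sub>0 \<in> affine hull eff_dom (f t)" using dom[OF t] by (rule hull_inc)
      show "f t (x\<^sub>0 + v) \<le> ereal M" if "v \<in> V" "x\<^sub>0 + v \<in> affine hull eff_dom (f t)" for v
        using V(3) that by blast
      show "Inf R \<le> r" if "(x\<^sub>0 - x, r) \<in> dir_epi (f t) x" for r
        using R(2) that by (intro cInf_lower) (auto simp: R_def u_def)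
      show "\<exists>r<Inf R + \<eta>. (x\<^sub>0 - x, r) \<in> dir_epi (f t) x" if "\<eta> > 0" for \<eta>
        using cInf_less_iff[OF R, of "Inf R + \<eta>"] that by (auto simp: R_def u_def)
    qed
    have "\<exists>\<psi>\<in>A t. c - \<delta> * Inf R - \<delta> \<le> \<psi> h" if "\<delta> > 0" "(h + \<delta> *\<^sub>R u, c) \<notin> dir_epi (f t) x" for h \<delta> c
      by (rule subdiff_support[of h \<delta> c \<delta>]) (use that True in \<open>auto simp: A_def u_def\<close>)
    then show ?thesis by blast
  next
    case False
    interpret Gamma0_at "f t" x "a t" by (rule at[OF t])
    have "\<exists>\<psi>\<in>A t. c - \<delta> * (b t + \<epsilon>) - \<delta> \<le> \<psi> h"
      if \<delta>: "\<delta> > 0" and notin: "(h + \<delta> *\<^sub>R u, c) \<notin> dir_epi (f t) x" for h \<delta> c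
    proof (rule eps_subdiff_support[OF \<epsilon> \<delta> notin])
      fix \<psi> assume \<psi>: "\<psi> \<in> eps_subdiff \<epsilon> (f t) x" "c - \<delta> \<le> \<psi> (h + \<delta> *\<^sub>R u)"
      interpret linear \<psi> using \<psi>(1) eps_subdiff_dual dual_linear by blast
      have "\<psi> (x\<^sub>0 - x) \<le> N t - a t + \<epsilon>" using \<psi>(1) eps_subdiff_finite_iff N[OF t] by simp
      then have "\<delta> * \<psi> u \<le> \<delta> * (b t + \<epsilon>)"
        using \<delta> unfolding u_def b_def by (intro mult_left_mono) auto
      then have "c - \<delta> * (b t + \<epsilon>) - \<delta> \<le> \<psi> h" using \<psi>(2) by (simp add: add scale)
      then show "\<exists>\<psi>\<in>A t. c - \<delta> * (b t + \<epsilon>) - \<delta> \<le> \<psi> h" using \<psi>(1) False by (auto simp: A_def)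
    qed
    then show ?thesis by blast
  qed
  then obtain B where support: "\<And>t h \<delta> c. t \<in> T \<Longrightarrow> \<delta> > 0 \<Longrightarrow>
      (h + \<delta> *\<^sub>R u, c) \<notin> dir_epi (f t) x \<Longrightarrow> \<exists>\<psi>\<in>A t. c - \<delta> * B t - \<delta> \<le> \<psi> h"
    by metis
  have ne: "A t \<noteq> {}" if t: "t \<in> T" for t
  proof -
    have "(0 + 1 *\<^sub>R u, low t - 1) \<notin> dir_epi (f t) x" using low[OF t, of "low t - 1"] by auto
    then show ?thesis using support[OF t zero_less_one] by blast
  qed
  have "\<phi> \<in> weak_star_topology closure_of (\<Sum>t\<in>T. A t)"
  proof (rule ccontr)
    assume notin: "\<phi> \<notin> weak_star_topology closure_of (\<Sum>t\<in>T. A t)"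
    have elim: "\<exists>g. \<psi> = (\<Sum>t\<in>T. g t) \<and> (\<forall>t\<in>T. g t \<in> A t)" if "\<psi> \<in> (\<Sum>t\<in>T. A t)" for \<psi>
      using that unfolding set_sum_alt[OF T] by blast
    have A_dual: "A t \<subseteq> topological_dual" for t using eps_subdiff_dual by (auto simp: A_def)
    have sum_dual: "(\<Sum>t\<in>I. g t) \<in> topological_dual" if "\<forall>t\<in>I. g t \<in> A t" for g I
      using that by (induction I rule: infinite_finite_induct) (use A_dual in \<open>auto intro: dual_zero dual_add\<close>)
    have sub: "(\<Sum>t\<in>T. A t) \<subseteq> topological_dual" using elim sum_dual by blast
    have cv: "convex (\<Sum>t\<in>T. A t)" by (intro convex_set_sum) (simp add: A_def convex_eps_subdiff)
    have nes: "(\<Sum>t\<in>T. A t) \<noteq> {}"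
    proof -
      have "\<forall>t\<in>T. \<exists>g. g \<in> A t" using ne by blast
      from bchoice[OF this] obtain g where "\<forall>t\<in>T. g t \<in> A t" by blast
      then have "(\<Sum>t\<in>T. g t) \<in> (\<Sum>t\<in>T. A t)" unfolding set_sum_alt[OF T] by blast
      then show ?thesis by blast
    qed
    obtain h \<eta> where \<eta>: "\<eta> > 0" and sep: "\<And>\<psi>. \<psi> \<in> (\<Sum>t\<in>T. A t) \<Longrightarrow> \<psi> h \<le> \<phi> h - \<eta>"
      by (rule weak_star_separation[OF eps_subdiff_dual[OF \<phi>] sub cv nes notin]) blast
    define m where "m t = (SUP \<psi>\<in>A t. \<psi> h)" for t
    have bdd: "bdd_above ((\<lambda>\<psi>. \<psi> h) ` A t)" if "t \<in> T" for t
      by (rule member_sum_le_imp_bdd(1)[OF T ne sep that])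
    have m_le: "\<psi> h \<le> m t" if "t \<in> T" "\<psi> \<in> A t" for t \<psi>
      unfolding m_def by (rule cSUP_upper[OF that(2) bdd[OF that(1)]])
    have sum_m: "(\<Sum>t\<in>T. m t) \<le> \<phi> h - \<eta>"
      unfolding m_def by (rule member_sum_le_imp_bdd(2)[OF T ne sep])
    interpret linear \<phi> by (rule dual_linear[OF eps_subdiff_dual[OF \<phi>]])
    define K where "K = (\<Sum>t\<in>T. B t + 2) - \<phi> u"
    have key: "\<eta> \<le> \<delta> * K" if \<delta>: "\<delta> > 0" for \<delta>
    proof -
      \<comment> \<open>Otherwise \<open>support\<close> would produce an element of \<open>A t\<close> with a value at \<open>h\<close> above the supremum \<open>m t\<close>.\<close>
      have "(h + \<delta> *\<^sub>R u, m t + \<delta> * (B t + 2)) \<in> dir_epi (f t) x" if t: "t \<in> T" for t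
      proof (rule ccontr)
        assume "(h + \<delta> *\<^sub>R u, m t + \<delta> * (B t + 2)) \<notin> dir_epi (f t) x"
        from support[OF t \<delta> this] obtain \<psi> where "\<psi> \<in> A t" "m t + \<delta> * (B t + 2) - \<delta> * B t - \<delta> \<le> \<psi> h"
          by blast
        then show False using m_le[OF t] \<delta> by (fastforce simp: algebra_simps)
      qed
      then have "\<phi> (h + \<delta> *\<^sub>R u) \<le> (\<Sum>t\<in>T. m t + \<delta> * (B t + 2))" by (intro dir_epi_common[OF T conv a \<phi>])
      then have "\<phi> h + \<delta> * \<phi> u \<le> (\<Sum>t\<in>T. m t) + \<delta> * (\<Sum>t\<in>T. B t + 2)"
        by (simp add: add scale sum.distrib[of m] sum_distrib_left)
      then show ?thesis using sum_m by (simp add: K_def algebra_simps)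
    qed
    \<comment> \<open>The step \<open>\<delta> = \<eta>/(2k)\<close> makes the right-hand side of \<open>key\<close> at most \<open>\<eta>/2\<close>.\<close>
    define k where "k = \<bar>K\<bar> + 1"
    have k: "k > 0" "K \<le> k" by (auto simp: k_def)
    have "\<eta> / (2 * k) * K \<le> \<eta> / (2 * k) * k"
      using \<eta> k by (intro mult_left_mono) auto
    also have "\<dots> = \<eta> / 2" using k(1) by simp
    finally have "\<eta> / (2 * k) * K \<le> \<eta> / 2" .
    moreover have "\<eta> \<le> \<eta> / (2 * k) * K" by (rule key) (use \<eta> k(1) in simp)
    ultimately show False using \<eta> by linarith
  qed
  then show ?thesis by (simp only: A_def)
qed

lemma sum_If_subset:
  fixes A B :: "'i \<Rightarrow> 'b::comm_monoid_add"
  assumes "finite T" and "T\<^sub>0 \<subseteq> T"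
  shows "(\<Sum>t\<in>T. if t \<in> T\<^sub>0 then A t else B t) = (\<Sum>t\<in>T\<^sub>0. A t) + (\<Sum>t\<in>T - T\<^sub>0. B t)"
proof -
  have "(\<Sum>t\<in>T. if t \<in> T\<^sub>0 then A t else B t) =
      (\<Sum>t\<in>T - T\<^sub>0. if t \<in> T\<^sub>0 then A t else B t) + (\<Sum>t\<in>T\<^sub>0. if t \<in> T\<^sub>0 then A t else B t)"
    by (rule sum.subset_diff[OF assms(2,1)])
  also have "(\<Sum>t\<in>T - T\<^sub>0. if t \<in> T\<^sub>0 then A t else B t) = (\<Sum>t\<in>T - T\<^sub>0. B t)" by (rule sum.cong) auto
  also have "(\<Sum>t\<in>T\<^sub>0. if t \<in> T\<^sub>0 then A t else B t) = (\<Sum>t\<in>T\<^sub>0. A t)" by (rule sum.cong) auto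
  finally show ?thesis by (simp add: add.commute)
qed

lemma closures_subset_subdiff_sum:
  fixes f :: "'i \<Rightarrow> 'a::locally_convex_space \<Rightarrow> ereal"
  assumes T: "finite T" and f: "\<And>t y. t \<in> T \<Longrightarrow> f t y > - \<infinity>"
    and \<phi>: "\<And>\<epsilon>. \<epsilon> > 0 \<Longrightarrow> \<phi> \<in> weak_star_topology closure_of
      (\<Sum>t\<in>T. if t \<in> T\<^sub>0 then subdiff (f t) x else eps_subdiff \<epsilon> (f t) x)"
  shows "\<phi> \<in> subdiff (\<lambda>y. \<Sum>t\<in>T. f t y) x"
proof (rule subdiff_of_closures[OF \<phi>])
  define n where "n = (\<Sum>t\<in>T. if t \<in> T\<^sub>0 then 0 else 1 :: real)"
  show "n \<ge> 0" by (auto simp: n_def intro: sum_nonneg)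
  fix \<epsilon> :: real and \<psi>
  assume "\<psi> \<in> (\<Sum>t\<in>T. if t \<in> T\<^sub>0 then subdiff (f t) x else eps_subdiff \<epsilon> (f t) x)"
  then obtain g where \<psi>: "\<psi> = (\<Sum>t\<in>T. g t)"
    and g: "\<forall>t\<in>T. g t \<in> (if t \<in> T\<^sub>0 then subdiff (f t) x else eps_subdiff \<epsilon> (f t) x)"
    unfolding set_sum_alt[OF T] by blast
  have "(\<Sum>t\<in>T. g t) \<in> eps_subdiff (\<Sum>t\<in>T. if t \<in> T\<^sub>0 then 0 else \<epsilon>) (\<lambda>y. \<Sum>t\<in>T. f t y) x"
    by (rule eps_subdiff_sum[OF T]) (use g f in \<open>auto split: if_splits\<close>)
  also have "(\<Sum>t\<in>T. if t \<in> T\<^sub>0 then 0 else \<epsilon>) = n * \<epsilon>"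
    unfolding n_def sum_distrib_right by (rule sum.cong) auto
  finally show "\<psi> \<in> eps_subdiff (n * \<epsilon>) (\<lambda>y. \<Sum>t\<in>T. f t y) x" unfolding \<psi> .
qed

text \<open>
  The only consequence of continuity that the sum rules need; \<open>H\<close> is an affine hull in (i) and the whole
  space in (ii).
\<close>

lemma bounded_above_near:
  fixes f :: "'a::locally_convex_space \<Rightarrow> ereal"
  assumes f: "f \<in> Gamma0" and x: "x \<in> eff_dom f" and cont: "(f \<longlongrightarrow> f x) (at x within H)"
  shows "\<exists>V M. open V \<and> 0 \<in> V \<and> (\<forall>v\<in>V. x + v \<in> H \<longrightarrow> f (x + v) \<le> ereal M)"
proof -
  obtain N where N: "f x = ereal N"
    using x Gamma0_gt_MInf[OF f, of x] by (cases "f x") (auto simp: eff_dom_def)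
  have "f x < ereal (N + 1)" using N by simp
  with cont have "eventually (\<lambda>y. f y < ereal (N + 1)) (at x within H)"
    by (rule order_tendstoD(2))
  then obtain S where S: "open S" "x \<in> S" "\<forall>y\<in>S. y \<noteq> x \<longrightarrow> y \<in> H \<longrightarrow> f y < ereal (N + 1)"
    unfolding eventually_at_topological by blast
  have "open {v. x + v \<in> S}"
    by (intro open_Collect_mem S(1) continuous_on_add continuous_on_const continuous_on_id)
  moreover have "f (x + v) \<le> ereal (N + 1)" if "x + v \<in> S" "x + v \<in> H" for v
    using S(3) that N by (cases "v = 0") (auto intro: less_imp_le)
  ultimately show ?thesis using S(2) by (intro exI[of _ "{v. x + v \<in> S}"] exI[of _ "N + 1"]) auto
qed

theorem corollary4:
  fixes f :: "'i \<Rightarrow> 'a::{locally_convex_space,t2_space} \<Rightarrow> ereal"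
    and T T\<^sub>0 :: "'i set"
  assumes "finite T"
    and "\<forall>t\<in>T. f t \<in> Gamma0"
    and "T\<^sub>0 \<subseteq> T"
  shows
    "((\<Inter>t\<in>T\<^sub>0. rel_interior (eff_dom (f t))) \<inter> (\<Inter>t\<in>T - T\<^sub>0. eff_dom (f t)) \<noteq> {} \<and>
      (\<forall>t\<in>T\<^sub>0. \<forall>x\<in>rel_interior (eff_dom (f t)).
         continuous (at x within affine hull (eff_dom (f t))) (f t))
      \<longrightarrow>
      (\<forall>x. subdiff (\<lambda>y. \<Sum>t\<in>T. f t y) x =
        (\<Inter>\<epsilon>\<in>{0<..}. weak_star_topology closure_of
           ((\<Sum>t\<in>T\<^sub>0. subdiff (f t) x) + (\<Sum>t\<in>T - T\<^sub>0. eps_subdiff \<epsilon> (f t) x)))))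
     \<and>
     ((\<Inter>t\<in>T\<^sub>0. interior (eff_dom (f t))) \<inter> (\<Inter>t\<in>T - T\<^sub>0. eff_dom (f t)) \<noteq> {} \<and>
      (\<forall>t\<in>T\<^sub>0. continuous_on (interior (eff_dom (f t))) (f t))
      \<longrightarrow>
      (\<forall>x. subdiff (\<lambda>y. \<Sum>t\<in>T. f t y) x =
        (\<Sum>t\<in>T\<^sub>0. subdiff (f t) x) +
        (\<Inter>\<epsilon>\<in>{0<..}. weak_star_topology closure_of
           (\<Sum>t\<in>T - T\<^sub>0. eps_subdiff \<epsilon> (f t) x))))"
proof (intro conjI impI allI; elim conjE)
  fix x
  assume "(\<Inter>t\<in>T\<^sub>0. rel_interior (eff_dom (f t))) \<inter> (\<Inter>t\<in>T - T\<^sub>0. eff_dom (f t)) \<noteq> {}"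
    and cont: "\<forall>t\<in>T\<^sub>0. \<forall>x\<in>rel_interior (eff_dom (f t)).
         continuous (at x within affine hull (eff_dom (f t))) (f t)"
  then obtain x\<^sub>0 where ri: "\<And>t. t \<in> T\<^sub>0 \<Longrightarrow> x\<^sub>0 \<in> rel_interior (eff_dom (f t))"
    and dom': "\<And>t. t \<in> T - T\<^sub>0 \<Longrightarrow> x\<^sub>0 \<in> eff_dom (f t)" by blast
  have f: "\<And>t. t \<in> T \<Longrightarrow> f t \<in> Gamma0" using assms(2) by blast
  have dom: "x\<^sub>0 \<in> eff_dom (f t)" if "t \<in> T" for t
    using dom'[of t] ri[of t] rel_interior_subset[of "eff_dom (f t)"] that by blast
  have near: "\<exists>V M. open V \<and> 0 \<in> V \<and>
      (\<forall>v\<in>V. x\<^sub>0 + v \<in> affine hull (eff_dom (f t)) \<longrightarrow> f t (x\<^sub>0 + v) \<le> ereal M)" if t: "t \<in> T\<^sub>0" for t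
    using t assms(3) cont ri by (intro bounded_above_near f dom) (auto simp: continuous_within)
  have "subdiff (\<lambda>y. \<Sum>t\<in>T. f t y) x = (\<Inter>\<epsilon>\<in>{0<..}. weak_star_topology closure_of
      (\<Sum>t\<in>T. if t \<in> T\<^sub>0 then subdiff (f t) x else eps_subdiff \<epsilon> (f t) x))"
    (is "?L = ?R")
  proof
    show "?L \<subseteq> ?R"
      using subdiff_sum_subset_closure[OF assms(1) f assms(3) dom near] by auto
    show "?R \<subseteq> ?L"
    proof
      fix \<phi> assume "\<phi> \<in> ?R"
      then show "\<phi> \<in> ?L"
        by (intro closures_subset_subdiff_sum[OF assms(1) Gamma0_gt_MInf[OF f]]) auto
    qed
  qed
  then show "subdiff (\<lambda>y. \<Sum>t\<in>T. f t y) x =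
        (\<Inter>\<epsilon>\<in>{0<..}. weak_star_topology closure_of
           ((\<Sum>t\<in>T\<^sub>0. subdiff (f t) x) + (\<Sum>t\<in>T - T\<^sub>0. eps_subdiff \<epsilon> (f t) x)))"
    unfolding sum_If_subset[OF assms(1,3)] .
next
  fix x
  assume "(\<Inter>t\<in>T\<^sub>0. interior (eff_dom (f t))) \<inter> (\<Inter>t\<in>T - T\<^sub>0. eff_dom (f t)) \<noteq> {}"
    and cont: "\<forall>t\<in>T\<^sub>0. continuous_on (interior (eff_dom (f t))) (f t)"
  then obtain x\<^sub>0 where int: "\<And>t. t \<in> T\<^sub>0 \<Longrightarrow> x\<^sub>0 \<in> interior (eff_dom (f t))"
    and dom: "\<And>t. t \<in> T - T\<^sub>0 \<Longrightarrow> x\<^sub>0 \<in> eff_dom (f t)" by blast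
  have f: "\<And>t. t \<in> T \<Longrightarrow> f t \<in> Gamma0" using assms(2) by blast
  have fin: "finite T\<^sub>0" "finite (T - T\<^sub>0)" using assms(1,3) finite_subset by auto
  define G where "G y = (\<Sum>t\<in>T - T\<^sub>0. f t y)" for y
  have eq: "(\<lambda>y. \<Sum>t\<in>T. f t y) = (\<lambda>y. (\<Sum>t\<in>T\<^sub>0. f t y) + G y)"
    unfolding G_def using sum.subset_diff[OF assms(3,1)] by (intro ext) (simp add: add.commute)
  have gt: "f t y > - \<infinity>" if "t \<in> T" for t y using Gamma0_gt_MInf f that by blast
  have sum_gt: "(\<Sum>t\<in>T\<^sub>0. f t y) > - \<infinity>" for y using gt assms(3) by (intro sum_ereal_gt_MInf) auto
  have G: "convex_fun G" "\<And>y. G y > - \<infinity>"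
    unfolding G_def using gt Gamma0_convex[OF f] by (blast intro: convex_fun_sum sum_ereal_gt_MInf)+
  have Gx\<^sub>0: "G x\<^sub>0 < \<infinity>"
  proof -
    have "f t x\<^sub>0 \<noteq> \<infinity>" if "t \<in> T - T\<^sub>0" for t using dom[OF that] by (simp add: eff_dom_def)
    then show ?thesis by (auto simp: G_def sum_Pinfty)
  qed
  have near: "\<exists>V M. open V \<and> 0 \<in> V \<and> (\<forall>v\<in>V. f t (x\<^sub>0 + v) \<le> ereal M)" if t: "t \<in> T\<^sub>0" for t
  proof -
    have "(f t \<longlongrightarrow> f t x\<^sub>0) (at x\<^sub>0)"
      using cont int[OF t] t by (auto simp: continuous_on_eq_continuous_at isCont_def)
    moreover have "x\<^sub>0 \<in> eff_dom (f t)" using int[OF t] interior_subset by blast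
    ultimately show ?thesis using bounded_above_near[of "f t" x\<^sub>0 UNIV] f t assms(3) by auto
  qed
  have subdiff_G: "subdiff G x = (\<Inter>\<epsilon>\<in>{0<..}. weak_star_topology closure_of
      (\<Sum>t\<in>T - T\<^sub>0. eps_subdiff \<epsilon> (f t) x))" (is "_ = ?R")
  proof
    show "subdiff G x \<subseteq> ?R"
    proof
      fix \<phi> assume \<phi>: "\<phi> \<in> subdiff G x"
      then obtain b where b: "G x = ereal b" by (rule eps_subdiff_at_finite)
      have x: "x \<in> eff_dom (f t)" if "t \<in> T - T\<^sub>0" for t
      proof -
        have "G x \<noteq> \<infinity>" using b by simp
        then have "f t x \<noteq> \<infinity>" using sum_Pinfty[of "\<lambda>t. f t x" "T - T\<^sub>0"] fin(2) that unfolding G_def by blast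
        then show ?thesis by (simp add: eff_dom_def)
      qed
      show "\<phi> \<in> ?R"
        using subdiff_sum_subset_closure[OF fin(2), of f "{}" x \<phi> x] f x \<phi> by (auto simp: G_def[abs_def])
    qed
    show "?R \<subseteq> subdiff G x"
    proof
      fix \<phi> assume \<phi>: "\<phi> \<in> ?R"
      show "\<phi> \<in> subdiff G x"
        using closures_subset_subdiff_sum[OF fin(2), of f \<phi> "{}" x] gt \<phi> by (auto simp: G_def[abs_def])
    qed
  qed
  have "subdiff (\<lambda>y. \<Sum>t\<in>T. f t y) x = (\<Sum>t\<in>T\<^sub>0. subdiff (f t) x) + subdiff G x"
  proof
    show "subdiff (\<lambda>y. \<Sum>t\<in>T. f t y) x \<subseteq> (\<Sum>t\<in>T\<^sub>0. subdiff (f t) x) + subdiff G x"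
    proof
      fix \<phi> assume "\<phi> \<in> subdiff (\<lambda>y. \<Sum>t\<in>T. f t y) x"
      then have \<phi>: "\<phi> \<in> subdiff (\<lambda>y. (\<Sum>t\<in>T\<^sub>0. f t y) + G y) x" unfolding eq .
      show "\<phi> \<in> (\<Sum>t\<in>T\<^sub>0. subdiff (f t) x) + subdiff G x"
        by (rule subdiff_sum_split[OF fin(1) _ _ near G Gx\<^sub>0 \<phi>])
          (use gt f assms(3) Gamma0_convex in blast)+
    qed
    show "(\<Sum>t\<in>T\<^sub>0. subdiff (f t) x) + subdiff G x \<subseteq> subdiff (\<lambda>y. \<Sum>t\<in>T. f t y) x"
    proof
      fix \<phi> assume "\<phi> \<in> (\<Sum>t\<in>T\<^sub>0. subdiff (f t) x) + subdiff G x"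
      then obtain \<psi> \<beta> where \<phi>: "\<phi> = \<psi> + \<beta>" and "\<psi> \<in> (\<Sum>t\<in>T\<^sub>0. subdiff (f t) x)"
        and \<beta>: "\<beta> \<in> subdiff G x" by (rule set_plus_elim)
      then obtain g where \<psi>: "\<psi> = (\<Sum>t\<in>T\<^sub>0. g t)" and g: "\<forall>t\<in>T\<^sub>0. g t \<in> subdiff (f t) x"
        unfolding set_sum_alt[OF fin(1)] by blast
      have "(\<Sum>t\<in>T\<^sub>0. g t) \<in> eps_subdiff (\<Sum>t\<in>T\<^sub>0. 0) (\<lambda>y. \<Sum>t\<in>T\<^sub>0. f t y) x"
        by (rule eps_subdiff_sum[OF fin(1)]) (use g gt assms(3) in blast)+
      then have "\<psi> \<in> subdiff (\<lambda>y. \<Sum>t\<in>T\<^sub>0. f t y) x" unfolding \<psi> sum.neutral_const .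
      from eps_subdiff_add[OF this \<beta> sum_gt G(2)]
      show "\<phi> \<in> subdiff (\<lambda>y. \<Sum>t\<in>T. f t y) x" unfolding eq \<phi> by simp
    qed
  qed
  then show "subdiff (\<lambda>y. \<Sum>t\<in>T. f t y) x =
        (\<Sum>t\<in>T\<^sub>0. subdiff (f t) x) +
        (\<Inter>\<epsilon>\<in>{0<..}. weak_star_topology closure_of
           (\<Sum>t\<in>T - T\<^sub>0. eps_subdiff \<epsilon> (f t) x))"
    unfolding subdiff_G .
qed

end
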